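(* Let $k$ be a field and let $A=kQ/I$ be a triangular gentle algebra. Then for all integers $n>1$ and $m>1$, $[{\rm HH}^n(A),{\rm HH}^m(A)]=0$, where $[-,-]$ is the Gerstenhaber bracket on Hochschild cohomology.
   Context: $Q$ is a finite quiver, $I$ an admissible ideal of $kQ$; paths are composed left to right. Triangular means $Q$ has no oriented cycles. $A$ is a string algebra if: (S1) $I$ is generated by paths; (S2) each vertex of $Q$ is the source of at most two arrows and the target of at most two arrows; (S3) for each arrow $\alpha$ there is at most one arrow $\beta$ with $\alpha\beta\notin I$ and at most one arrow $\gamma$ with $\gamma\alpha\notin I$. $A$ is gentle if it is a string algebra satisfying in addition (G1) for each arrow $\alpha$ there is at most one arrow $\beta$ with $\alpha\beta\in I$ and at most one arrow $\gamma$ with $\gamma\alpha\in I$, and (G2) $I$ is generated by paths of length 2. ${\rm HH}^i(A)={\rm Ext}^i_{A\otimes_kA^{op}}(A,A)$. The Gerstenhaber bracket: for Hochschild cochains $f$ of degree $n$ and $g$ of degree $m$, $(f\circ_i g)(r_1\otimes\cdots\otimes r_{n+m-1})=f(r_1\otimes\cdots\otimes r_{i-1}\otimes g(r_i\otimes\cdots\otimes r_{i+m-1})\otimes r_{i+m}\otimes\cdots\otimes r_{n+m-1})$, $f\circ g=\sum_{i=1}^n(-1)^{(i-1)(m-1)}f\circ_i g$ (and $f\circ g=0$ if $n=0$), $[f,g]=f\circ g-(-1)^{(n-1)(m-1)}g\circ f$; this induces a graded Lie bracket of degree $-1$ on ${\rm HH}^*(A)$. *)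

theory Defs
  imports Main
begin

record ('v,'a) quiver =
  verts :: "'v set"
  arrs  :: "'a set"
  src   :: "'a \<Rightarrow> 'v"
  tgt   :: "'a \<Rightarrow> 'v"

definition finite_quiver :: "('v,'a) quiver \<Rightarrow> bool" where
  "finite_quiver Q \<longleftrightarrow> finite (verts Q) \<and> finite (arrs Q) \<and>
     (\<forall>\<alpha>\<in>arrs Q. src Q \<alpha> \<in> verts Q \<and> tgt Q \<alpha> \<in> verts Q)"

text \<open>A path is a start vertex together with a (possibly empty) list of arrows;
  (v, []) is the trivial path e_v.\<close>
type_synonym ('v,'a) path = "'v \<times> 'a list"

definition is_path :: "('v,'a) quiver \<Rightarrow> ('v,'a) path \<Rightarrow> bool" where
  "is_path Q p \<longleftrightarrow> fst p \<in> verts Q \<and> set (snd p) \<subseteq> arrs Q \<and>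
     (snd p \<noteq> [] \<longrightarrow> src Q (hd (snd p)) = fst p) \<and>
     (\<forall>i. Suc i < length (snd p) \<longrightarrow> tgt Q (snd p ! i) = src Q (snd p ! Suc i))"

definition pstart :: "('v,'a) path \<Rightarrow> 'v" where
  "pstart p = fst p"

definition pend :: "('v,'a) quiver \<Rightarrow> ('v,'a) path \<Rightarrow> 'v" where
  "pend Q p = (if snd p = [] then fst p else tgt Q (last (snd p)))"

definition pcat :: "('v,'a) path \<Rightarrow> ('v,'a) path \<Rightarrow> ('v,'a) path" where
  "pcat p q = (fst p, snd p @ snd q)"

definition triangular :: "('v,'a) quiver \<Rightarrow> bool" where
  "triangular Q \<longleftrightarrow> (\<forall>p. is_path Q p \<and> snd p \<noteq> [] \<longrightarrow> pend Q p \<noteq> pstart p)"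

text \<open>The ideal I is generated by the length-2 paths \<alpha>\<beta> with (\<alpha>,\<beta>) \<in> R
  (this encodes (S1) and (G2)). Conditions (S2), (S3), (G1):\<close>
definition gentle :: "('v,'a) quiver \<Rightarrow> ('a \<times> 'a) set \<Rightarrow> bool" where
  "gentle Q R \<longleftrightarrow> finite_quiver Q \<and>
     R \<subseteq> {(\<alpha>,\<beta>). \<alpha> \<in> arrs Q \<and> \<beta> \<in> arrs Q \<and> tgt Q \<alpha> = src Q \<beta>} \<and>
     (\<forall>v\<in>verts Q. card {\<alpha>\<in>arrs Q. src Q \<alpha> = v} \<le> 2 \<and> card {\<alpha>\<in>arrs Q. tgt Q \<alpha> = v} \<le> 2) \<and>
     (\<forall>\<alpha>\<in>arrs Q. card {\<beta>\<in>arrs Q. tgt Q \<alpha> = src Q \<beta> \<and> (\<alpha>,\<beta>) \<notin> R} \<le> 1 \<and>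
                  card {\<gamma>\<in>arrs Q. tgt Q \<gamma> = src Q \<alpha> \<and> (\<gamma>,\<alpha>) \<notin> R} \<le> 1) \<and>
     (\<forall>\<alpha>\<in>arrs Q. card {\<beta>. (\<alpha>,\<beta>) \<in> R} \<le> 1 \<and> card {\<gamma>. (\<gamma>,\<alpha>) \<in> R} \<le> 1)"

text \<open>Paths not in I: they form a k-basis of A = kQ/I.\<close>
definition nz_path :: "('v,'a) quiver \<Rightarrow> ('a \<times> 'a) set \<Rightarrow> ('v,'a) path \<Rightarrow> bool" where
  "nz_path Q R p \<longleftrightarrow> is_path Q p \<and>
     (\<forall>i. Suc i < length (snd p) \<longrightarrow> (snd p ! i, snd p ! Suc i) \<notin> R)"

definition gbasis :: "('v,'a) quiver \<Rightarrow> ('a \<times> 'a) set \<Rightarrow> ('v,'a) path set" where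
  "gbasis Q R = {p. nz_path Q R p}"

text \<open>Elements of A are coefficient functions on paths (supported on the basis).
  Product of two basis paths, as an element of A.\<close>
definition bprod :: "('v,'a) quiver \<Rightarrow> ('a \<times> 'a) set \<Rightarrow> ('v,'a) path \<Rightarrow> ('v,'a) path
    \<Rightarrow> ('v,'a) path \<Rightarrow> 'k::field" where
  "bprod Q R p q r = (if pend Q p = pstart q \<and> nz_path Q R (pcat p q) \<and> r = pcat p q then 1 else 0)"

definition bvec :: "('v,'a) path \<Rightarrow> ('v,'a) path \<Rightarrow> 'k::field" where
  "bvec p r = (if r = p then 1 else 0)"

definition amul :: "('v,'a) quiver \<Rightarrow> ('a \<times> 'a) set \<Rightarrow> (('v,'a) path \<Rightarrow> 'k::field)
    \<Rightarrow> (('v,'a) path \<Rightarrow> 'k) \<Rightarrow> ('v,'a) path \<Rightarrow> 'k" where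
  "amul Q R x y r = (\<Sum>p\<in>gbasis Q R. \<Sum>q\<in>gbasis Q R. x p * y q * bprod Q R p q r)"

text \<open>Hochschild cochains of degree n: k-linear maps A^{\<otimes>n} \<rightarrow> A, given by their
  values on n-tuples (lists) of basis paths.\<close>
type_synonym ('v,'a,'k) cochain = "('v,'a) path list \<Rightarrow> ('v,'a) path \<Rightarrow> 'k"

definition is_cochain :: "('v,'a) quiver \<Rightarrow> ('a \<times> 'a) set \<Rightarrow> nat \<Rightarrow> ('v,'a,'k::field) cochain \<Rightarrow> bool" where
  "is_cochain Q R n f \<longleftrightarrow> (\<forall>bs r. length bs = n \<and> set bs \<subseteq> gbasis Q R \<and> r \<notin> gbasis Q R \<longrightarrow> f bs r = 0)"

definition hdiff :: "('v,'a) quiver \<Rightarrow> ('a \<times> 'a) set \<Rightarrow> nat \<Rightarrow> ('v,'a,'k::field) cochain \<Rightarrow> ('v,'a,'k) cochain" where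
  "hdiff Q R n f bs r =
     amul Q R (bvec (bs ! 0)) (f (tl bs)) r
     + (\<Sum>i\<in>{1..n}. (-1) ^ i * (\<Sum>c\<in>gbasis Q R. bprod Q R (bs ! (i - 1)) (bs ! i) c *
                                      f (take (i - 1) bs @ [c] @ drop (i + 1) bs) r))
     + (-1) ^ (n + 1) * amul Q R (f (take n bs)) (bvec (bs ! n)) r"

definition cocycle :: "('v,'a) quiver \<Rightarrow> ('a \<times> 'a) set \<Rightarrow> nat \<Rightarrow> ('v,'a,'k::field) cochain \<Rightarrow> bool" where
  "cocycle Q R n f \<longleftrightarrow> is_cochain Q R n f \<and>
     (\<forall>bs r. length bs = Suc n \<and> set bs \<subseteq> gbasis Q R \<longrightarrow> hdiff Q R n f bs r = 0)"

definition coboundary :: "('v,'a) quiver \<Rightarrow> ('a \<times> 'a) set \<Rightarrow> nat \<Rightarrow> ('v,'a,'k::field) cochain \<Rightarrow> bool" where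
  "coboundary Q R n f \<longleftrightarrow> 1 \<le> n \<and> (\<exists>h. is_cochain Q R (n - 1) h \<and>
     (\<forall>bs r. length bs = n \<and> set bs \<subseteq> gbasis Q R \<longrightarrow> f bs r = hdiff Q R (n - 1) h bs r))"

definition circ_i :: "('v,'a) quiver \<Rightarrow> ('a \<times> 'a) set \<Rightarrow> nat \<Rightarrow> ('v,'a,'k::field) cochain
    \<Rightarrow> ('v,'a,'k) cochain \<Rightarrow> nat \<Rightarrow> ('v,'a,'k) cochain" where
  "circ_i Q R m f g i bs r = (\<Sum>c\<in>gbasis Q R. g (take m (drop (i - 1) bs)) c *
                                f (take (i - 1) bs @ [c] @ drop (i - 1 + m) bs) r)"

definition gcirc :: "('v,'a) quiver \<Rightarrow> ('a \<times> 'a) set \<Rightarrow> nat \<Rightarrow> nat \<Rightarrow> ('v,'a,'k::field) cochain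
    \<Rightarrow> ('v,'a,'k) cochain \<Rightarrow> ('v,'a,'k) cochain" where
  "gcirc Q R n m f g bs r =
     (if n = 0 then 0 else (\<Sum>i\<in>{1..n}. (-1) ^ ((i - 1) * (m - 1)) * circ_i Q R m f g i bs r))"

definition gbracket :: "('v,'a) quiver \<Rightarrow> ('a \<times> 'a) set \<Rightarrow> nat \<Rightarrow> nat \<Rightarrow> ('v,'a,'k::field) cochain
    \<Rightarrow> ('v,'a,'k) cochain \<Rightarrow> ('v,'a,'k) cochain" where
  "gbracket Q R n m f g bs r =
     gcirc Q R n m f g bs r - (-1) ^ ((n - 1) * (m - 1)) * gcirc Q R m n g f bs r"

end

theory Submission
  imports Defs
begin

text \<open>
  Gentle algebras are quadratic monomial, so a Hochschild cocycle is controlled by its values on the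
  Koszul tuples: lists of arrows in which every two neighbours multiply to zero. After subtracting
  coboundaries, a cocycle vanishes on tuples with a trivial path, with non-composable neighbours or
  with two neighbours whose product is nonzero; in this normal form it is determined by its Koszul
  values, and these can moreover be chosen without components that end in the last arrow of the
  tuple. If one normal cocycle is inserted into another on a Koszul tuple, the inserted path \<open>c\<close> is
  parallel to a Koszul tuple of length at least two. By condition (G1) the arrow to the right of \<open>c\<close>
  forces \<open>c\<close> to end in the last arrow of the inserted tuple; if there is none, then \<open>c\<close> starts with
  the first arrow of that tuple and (S3), together with the absence of oriented cycles, gives a
  contradiction. So the bracket of normal cocycles vanishes on Koszul tuples, hence is a coboundary;
  the graded Jacobi identity shows that the normalisation changes the bracket by a coboundary only.
\<close>

subsection \<open>Insertion of cochains and the graded Jacobi identity\<close>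

text \<open>Everything happens in the bar complex. The passage to Koszul values, usually a
  comparison with the minimal resolution, is made by explicit homotopies, since the bracket is given
  on bar cochains. The obstacle is that a correction may undo an earlier one, and this fixes the
  order. Trivial paths come before anything else, because vanishing there forces the vertices of
  neighbouring arguments and of values to match. Components ending in the last arrow are removed
  before the tuples with a nonzero product are treated, because the homotopies for the latter vanish
  on lists of arrows and so leave all Koszul values alone. Only incidences at the right end are
  cleared, which is why the insertion argument is not symmetric. Degrees above one enter through the
  clearing homotopy: it needs the next arrow of a Koszul tuple, and (G1) determines this arrow only
  if the tuple is nonempty.\<close>

text \<open>The degree argument \<open>p\<close> is the degree of the cochain \<open>g\<close> minus one. The argument \<open>F\<close> is scalar-valued:
  a cochain \<open>f\<close> enters through its coefficient functions \<open>\<lambda>z. f z r\<close>, which allows induction on the list.\<close>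

definition coder :: "'p set \<Rightarrow> nat \<Rightarrow> ('p list \<Rightarrow> 'p \<Rightarrow> 'k::comm_ring_1) \<Rightarrow> ('p list \<Rightarrow> 'k) \<Rightarrow> 'p list \<Rightarrow> 'k" where
  "coder B p g F bs = (\<Sum>i<length bs - p. (-1) ^ (i * p) *
     (\<Sum>c\<in>B. g (take (Suc p) (drop i bs)) c * F (take i bs @ c # drop (i + Suc p) bs)))"

text \<open>The \<open>i = 0\<close> summand of \<open>coder\<close>; splitting it off yields the
  recursion \<open>coder_Cons\<close>. The guard matters because \<open>take\<close> would otherwise
  hand \<open>g\<close> a block that is too short.\<close>

definition front :: "'p set \<Rightarrow> nat \<Rightarrow> ('p list \<Rightarrow> 'p \<Rightarrow> 'k::comm_ring_1) \<Rightarrow> ('p list \<Rightarrow> 'k) \<Rightarrow> 'p list \<Rightarrow> 'k" where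
  "front B p g F bs = (if p < length bs
     then \<Sum>c\<in>B. g (take (Suc p) bs) c * F (c # drop (Suc p) bs) else 0)"

text \<open>The Gerstenhaber bracket in shifted degrees: \<open>p\<close> and \<open>q\<close> are
  the degrees of \<open>g\<close> and \<open>h\<close> minus one, and \<open>coder B q h\<close>
  applied to a coefficient function of \<open>g\<close> is the circle product of \<open>g\<close>
  with \<open>h\<close>.\<close>

definition brkt :: "'p set \<Rightarrow> nat \<Rightarrow> nat \<Rightarrow> ('p list \<Rightarrow> 'p \<Rightarrow> 'k::comm_ring_1) \<Rightarrow> ('p list \<Rightarrow> 'p \<Rightarrow> 'k) \<Rightarrow>
    'p list \<Rightarrow> 'p \<Rightarrow> 'k" where
  "brkt B p q g h z r = coder B q h (\<lambda>z. g z r) z - (-1) ^ (p * q) * coder B p g (\<lambda>z. h z r) z"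

lemma coder_Nil [simp]: "coder B p g F [] = 0"
  by (simp add: coder_def)

lemma coder_Cons: "coder B p g F (b # bs) = front B p g F (b # bs) + (-1) ^ p * coder B p g (\<lambda>z. F (b # z)) bs"
proof (cases "p \<le> length bs")
  case True
  then have "length (b # bs) - p = Suc (length bs - p)" by simp
  then show ?thesis using True
    by (simp add: coder_def front_def sum.lessThan_Suc_shift power_add sum_distrib_left mult_ac
        del: sum.lessThan_Suc)
next
  case False
  then show ?thesis by (simp add: coder_def front_def)
qed

lemma coder_diff: "coder B p g (\<lambda>z. F z - c * G z) bs = coder B p g F bs - c * coder B p g G bs"
  by (simp add: coder_def right_diff_distrib sum_subtractf sum_distrib_left mult_ac)

lemma coder_add: "coder B p g (\<lambda>z. F z + c * G z) bs = coder B p g F bs + c * coder B p g G bs"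
  by (simp add: coder_def distrib_left sum.distrib sum_distrib_left mult_ac)

lemma front_diff_left: "front B p (\<lambda>z r. g z r - c * h z r) F bs = front B p g F bs - c * front B p h F bs"
  by (simp add: front_def left_diff_distrib right_diff_distrib sum_subtractf sum_distrib_left mult_ac)

lemma sum_lessThan_add: "(\<Sum>i<m + k. f i) = (\<Sum>i<m. f i) + (\<Sum>i<k. f (m + i :: nat))"
  for f :: "nat \<Rightarrow> 'b::comm_monoid_add"
  by (induction k) (simp_all add: add.assoc)

text \<open>The first summand collects the insertions of \<open>h\<close> into the leading block that \<open>g\<close> reads, the second one
  those to the right of this block.\<close>

lemma coder_front:
  "coder B q h (front B p g F) bs =
     front B (p + q) (\<lambda>z r. coder B q h (\<lambda>z. g z r) z) F bs +
     (-1) ^ (q * Suc p) * (if p < length bs then \<Sum>c\<in>B. g (take (Suc p) bs) c *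
        coder B q h (\<lambda>z. F (c # z)) (drop (Suc p) bs) else 0)"
proof (cases "p + q < length bs")
  case False
  have "front B p g F (take i bs @ c # drop (i + Suc q) bs) = 0" if "i < length bs - q" for i c
    using that False by (simp add: front_def)
  then show ?thesis using False
    by (simp add: coder_def) (simp add: front_def)
next
  case True
  define k where "k = length bs - q - Suc p"
  have len: "length bs - q = Suc p + k" using True by (simp add: k_def)
  let ?H = "\<lambda>i c. h (take (Suc q) (drop i bs)) c"
  let ?L = "\<lambda>i c. take i bs @ c # drop (i + Suc q) bs"
  let ?z = "take (Suc (p + q)) bs"
  have 1: "(\<Sum>i<Suc p. (-1) ^ (i * q) * (\<Sum>c\<in>B. ?H i c * front B p g F (?L i c))) =
        front B (p + q) (\<lambda>z r. coder B q h (\<lambda>z. g z r) z) F bs" 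
  proof -
    have a: "front B p g F (?L i c) =
        (\<Sum>d\<in>B. g (take i ?z @ c # drop (i + Suc q) ?z) d * F (d # drop (Suc (p + q)) bs))"
      if "i < Suc p" for i c
    proof -
      have "take (Suc p) (?L i c) = take i ?z @ c # drop (i + Suc q) ?z"
        using that True by (simp add: take_Cons' drop_take min_def Suc_diff_le)
      moreover have "drop (Suc p) (?L i c) = drop (Suc (p + q)) bs"
        using that True by (simp add: drop_Cons' min_def)
      moreover have "p < length (?L i c)" using that True by simp
      ultimately show ?thesis by (simp only: front_def if_True)
    qed
    have "(\<Sum>i<Suc p. (-1) ^ (i * q) * (\<Sum>c\<in>B. ?H i c * front B p g F (?L i c))) =
      (\<Sum>i<Suc p. \<Sum>d\<in>B. ((-1) ^ (i * q) * (\<Sum>c\<in>B. h (take (Suc q) (drop i ?z)) c *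
          g (take i ?z @ c # drop (i + Suc q) ?z) d)) * F (d # drop (Suc (p + q)) bs))"
    proof (rule sum.cong[OF refl], goal_cases)
      case (1 i)
      then have i: "i < Suc p" by simp
      have t: "take (Suc q) (drop i ?z) = take (Suc q) (drop i bs)"
        using i by (simp add: drop_take min_def)
      show ?case unfolding a[OF i] t sum_distrib_left sum_distrib_right
        by (subst sum.swap) (simp only: mult.assoc)
    qed
    also have "\<dots> = (\<Sum>d\<in>B. \<Sum>i<Suc p. ((-1) ^ (i * q) * (\<Sum>c\<in>B. h (take (Suc q) (drop i ?z)) c *
          g (take i ?z @ c # drop (i + Suc q) ?z) d)) * F (d # drop (Suc (p + q)) bs))"
      by (rule sum.swap)
    also have "\<dots> = (\<Sum>d\<in>B. coder B q h (\<lambda>z. g z d) ?z * F (d # drop (Suc (p + q)) bs))"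
    proof -
      have "length ?z - q = Suc p" using True by simp
      then show ?thesis by (simp only: coder_def sum_distrib_right)
    qed
    finally show ?thesis using True by (simp only: front_def if_True)
  qed
  have 2: "(\<Sum>i<k. (-1) ^ ((Suc p + i) * q) * (\<Sum>c\<in>B. ?H (Suc p + i) c * front B p g F (?L (Suc p + i) c))) =
     (-1) ^ (q * Suc p) * (\<Sum>c\<in>B. g (take (Suc p) bs) c * coder B q h (\<lambda>z. F (c # z)) (drop (Suc p) bs))"
  proof -
    have k: "length (drop (Suc p) bs) - q = k" by (simp add: k_def)
    have f: "front B p g F (?L (Suc p + i) c) = (\<Sum>d\<in>B. g (take (Suc p) bs) d *
        F (d # (take i (drop (Suc p) bs) @ c # drop (i + Suc q) (drop (Suc p) bs))))" if "i < k" for i c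
    proof -
      have "take (Suc p) (?L (Suc p + i) c) = take (Suc p) bs"
        using True by (simp add: min_def)
      moreover have "drop (Suc p) (?L (Suc p + i) c) = take i (drop (Suc p) bs) @ c # drop (i + Suc q) (drop (Suc p) bs)"
        using True that by (simp add: drop_take add_ac)
      moreover have "p < length (?L (Suc p + i) c)" using True by simp
      ultimately show ?thesis by (simp only: front_def if_True)
    qed
    let ?X = "\<lambda>i c d. (-1) ^ (q * Suc p) * (g (take (Suc p) bs) d * ((-1) ^ (i * q) *
        (h (take (Suc q) (drop i (drop (Suc p) bs))) c *
         F (d # take i (drop (Suc p) bs) @ c # drop (i + Suc q) (drop (Suc p) bs)))))"
    have "(\<Sum>i<k. (-1) ^ ((Suc p + i) * q) * (\<Sum>c\<in>B. ?H (Suc p + i) c * front B p g F (?L (Suc p + i) c)))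
        = (\<Sum>i<k. \<Sum>d\<in>B. \<Sum>c\<in>B. ?X i c d)"
    proof (rule sum.cong[OF refl], goal_cases)
      case (1 i)
      then have i: "i < k" by simp
      have "(-1) ^ ((Suc p + i) * q) * (?H (Suc p + i) c * front B p g F (?L (Suc p + i) c)) = (\<Sum>d\<in>B. ?X i c d)" for c
        unfolding f[OF i] sum_distrib_left
        by (rule sum.cong[OF refl]) (simp add: power_add algebra_simps)
      then show ?case by (simp only: sum_distrib_left) (rule sum.swap)
    qed
    also have "\<dots> = (\<Sum>d\<in>B. \<Sum>i<k. \<Sum>c\<in>B. ?X i c d)"
      by (rule sum.swap)
    also have "\<dots> = (-1) ^ (q * Suc p) * (\<Sum>d\<in>B. g (take (Suc p) bs) d *
        coder B q h (\<lambda>z. F (d # z)) (drop (Suc p) bs))"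
      by (simp only: coder_def k sum_distrib_left)
    finally show ?thesis .
  qed
  show ?thesis using True
    by (subst coder_def, unfold len sum_lessThan_add 1 2) (simp add: front_def)
qed

text \<open>Dual form of the fact that coderivations of the tensor coalgebra are closed under the
  graded commutator. Insertions into disjoint blocks occur in both orders and cancel by their signs;
  only nested insertions survive. \<open>F\<close> must be arbitrary, because the induction replaces
  it by \<open>\<lambda>z. F (b # z)\<close>.\<close>

theorem coder_commutator:
  fixes g h :: "'p list \<Rightarrow> 'p \<Rightarrow> 'k::comm_ring_1"
  shows "coder B q h (coder B p g F) bs - (-1) ^ (p * q) * coder B p g (coder B q h F) bs =
   coder B (p + q) (brkt B p q g h) F bs"
proof (induction bs arbitrary: F)
  case (Cons b bs)
  let ?T = "\<lambda>p g q h. if p < length (b # bs) then \<Sum>c\<in>B. g (take (Suc p) (b # bs)) c *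
        coder B q h (\<lambda>z. F (c # z)) (drop (Suc p) (b # bs)) else 0"
  have expand: "coder B q h (coder B p g F) (b # bs) =
       front B (p + q) (\<lambda>z r. coder B q h (\<lambda>z. g z r) z) F (b # bs) + (-1) ^ (q * Suc p) * ?T p g q h +
       (-1) ^ p * ?T q h p g + (-1) ^ (p + q) * coder B q h (coder B p g (\<lambda>z. F (b # z))) bs" for p q g h
  proof -
    have "coder B q h (coder B p g F) (b # bs) = front B q h (coder B p g F) (b # bs)
        + (-1) ^ q * coder B q h (\<lambda>z. front B p g F (b # z) + (-1) ^ p * coder B p g (\<lambda>z. F (b # z)) z) bs"
      by (subst coder_Cons) (simp only: coder_Cons)
    also have "\<dots> = front B q h (coder B p g F) (b # bs) + (-1) ^ q * coder B q h (\<lambda>z. front B p g F (b # z)) bs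
       + (-1) ^ (p + q) * coder B q h (coder B p g (\<lambda>z. F (b # z))) bs"
      by (simp add: coder_add power_add algebra_simps)
    also have "front B q h (coder B p g F) (b # bs) = front B q h (front B p g F) (b # bs) + (-1) ^ p * ?T q h p g"
      by (simp add: front_def coder_Cons distrib_left sum.distrib sum_distrib_left mult_ac del: take_Suc_Cons)
    also have "front B q h (front B p g F) (b # bs) + (-1) ^ p * ?T q h p g +
       (-1) ^ q * coder B q h (\<lambda>z. front B p g F (b # z)) bs = 
       coder B q h (front B p g F) (b # bs) + (-1) ^ p * ?T q h p g"
      by (simp add: coder_Cons[of B q h "front B p g F"])
    finally show ?thesis unfolding coder_front .
  qed
  \<comment> \<open>\<open>T\<close> and \<open>S\<close> are the mixed terms, in which one cochain
    reads the leading block and the other acts to the right of it; both drop out.\<close>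
  have arith: "X + (-1) ^ (q * Suc p) * T + (-1) ^ p * S + e * D -
      (-1) ^ (p * q) * (Y + (-1) ^ (p * Suc q) * S + (-1) ^ q * T + e * E) =
      X - (-1) ^ (p * q) * Y + e * (D - (-1) ^ (p * q) * E)" for X Y S T D E e :: 'k
  proof -
    have "(-1) ^ (p * q) * (-1) ^ (p * Suc q) = ((-1) ^ p :: 'k)"
    proof -
      have "p * q + p * Suc q = 2 * (p * q) + p" by simp
      then show ?thesis by (metis power_add power_mult power_minus1_even mult_1)
    qed
    then have "(-1) ^ (p * q) * ((-1) ^ (p * Suc q) * S) = (-1) ^ p * S"
      by (metis mult.assoc)
    moreover have "(-1) ^ (q * Suc p) * T = (-1) ^ (p * q) * ((-1) ^ q * T)"
      by (simp add: power_add mult_ac)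
    ultimately show ?thesis by (simp only: distrib_left right_diff_distrib) (simp add: mult.left_commute)
  qed
  show ?case
    unfolding expand add.commute[of q p] mult.commute[of q p] arith coder_Cons[of B "p + q"]
      Cons.IH[symmetric] 
    by (simp only: brkt_def[abs_def] front_diff_left)
qed simp

text \<open>Insertion of an inner bracket is rewritten by \<open>coder_commutator\<close> as a
  commutator of insertions. What remains compares triple compositions, so no associator has to be
  computed.\<close>

theorem brkt_Jacobi:
  fixes f g u :: "'p list \<Rightarrow> 'p \<Rightarrow> 'k::comm_ring_1"
  shows "brkt B (p + q) s (brkt B p q f g) u z r =
   (-1) ^ (q * s) * brkt B (p + s) q (brkt B p s f u) g z r + brkt B p (q + s) f (brkt B q s g u) z r"
proof -
  have sq: "(-1) ^ a * ((-1) ^ a * x) = (x::'k)" for a x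
    by (metis left_minus_one_mult_self)
  note c = coder_commutator[symmetric]
  show ?thesis
    unfolding brkt_def[of B "p+q"] brkt_def[of B "p+s"] brkt_def[of B p "q+s"] c
    unfolding brkt_def coder_diff
    by (simp add: power_add distrib_left distrib_right mult.commute[of q p] mult.commute[of s p]
        mult.commute[of s q]) (simp add: algebra_simps sq)
qed

subsection \<open>Paths in a triangular gentle algebra\<close>

declare split_paired_All [simp del] split_paired_Ex [simp del]

lemma card_le_oneD: "x = y" if "card A \<le> 1" "finite A" "x \<in> A" "y \<in> A"
  using that by (auto simp: card_le_Suc0_iff_eq)

abbreviation triv :: "'v \<Rightarrow> ('v,'a) path" where
  "triv v \<equiv> (v, [])"

locale triangular_gentle =
  fixes Q :: "('v,'a) quiver" and R :: "('a \<times> 'a) set"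
  assumes gentle: "gentle Q R" and triangular: "triangular Q"
begin

abbreviation B where "B \<equiv> gbasis Q R"
abbreviation pnd where "pnd \<equiv> pend Q"

definition nzprod :: "('v,'a) path \<Rightarrow> ('v,'a) path \<Rightarrow> bool" where
  "nzprod p q \<longleftrightarrow> pnd p = pstart q \<and> nz_path Q R (pcat p q)"

lemma finite_quiver: "finite_quiver Q"
  using gentle by (simp add: gentle_def)

lemma R_arrows: "(a, b) \<in> R \<Longrightarrow> a \<in> arrs Q \<and> b \<in> arrs Q \<and> tgt Q a = src Q b"
  using gentle unfolding gentle_def by auto

lemma R_right_unique: "(a, b) \<in> R \<Longrightarrow> (a, b') \<in> R \<Longrightarrow> b = b'"
proof -
  assume *: "(a, b) \<in> R" "(a, b') \<in> R"
  have "card {\<beta>. (a, \<beta>) \<in> R} \<le> 1" using gentle R_arrows[OF *(1)] by (simp add: gentle_def)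
  moreover have "finite {\<beta>. (a, \<beta>) \<in> R}"
    using finite_quiver by (rule_tac finite_subset[of _ "arrs Q"]) (auto simp: finite_quiver_def dest: R_arrows)
  ultimately show ?thesis by (rule card_le_oneD) (use * in auto)
qed

lemma R_left_unique: "(a, b) \<in> R \<Longrightarrow> (a', b) \<in> R \<Longrightarrow> a = a'"
proof -
  assume *: "(a, b) \<in> R" "(a', b) \<in> R"
  have "card {\<alpha>. (\<alpha>, b) \<in> R} \<le> 1" using gentle R_arrows[OF *(1)] by (simp add: gentle_def)
  moreover have "finite {\<alpha>. (\<alpha>, b) \<in> R}"
    using finite_quiver by (rule_tac finite_subset[of _ "arrs Q"]) (auto simp: finite_quiver_def dest: R_arrows)
  ultimately show ?thesis by (rule card_le_oneD) (use * in auto)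
qed

lemma notR_left_unique:
  assumes "a \<in> arrs Q" "a' \<in> arrs Q" "b \<in> arrs Q" "tgt Q a = src Q b" "tgt Q a' = src Q b"
    "(a, b) \<notin> R" "(a', b) \<notin> R"
  shows "a = a'"
proof -
  have "card {\<gamma>\<in>arrs Q. tgt Q \<gamma> = src Q b \<and> (\<gamma>, b) \<notin> R} \<le> 1"
    using gentle assms(3) by (simp add: gentle_def)
  moreover have "finite {\<gamma>\<in>arrs Q. tgt Q \<gamma> = src Q b \<and> (\<gamma>, b) \<notin> R}"
    using finite_quiver by (simp add: finite_quiver_def)
  ultimately show ?thesis by (rule card_le_oneD) (use assms in auto)
qed

lemma is_path_iff: "is_path Q (v, as) \<longleftrightarrow> v \<in> verts Q \<and> set as \<subseteq> arrs Q \<and>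
    (as \<noteq> [] \<longrightarrow> src Q (hd as) = v) \<and> successively (\<lambda>a b. tgt Q a = src Q b) as"
  by (auto simp: is_path_def successively_conv_nth Suc_less_eq)

lemma nz_path_iff: "nz_path Q R (v, as) \<longleftrightarrow> v \<in> verts Q \<and> set as \<subseteq> arrs Q \<and>
    (as \<noteq> [] \<longrightarrow> src Q (hd as) = v) \<and> successively (\<lambda>a b. tgt Q a = src Q b \<and> (a, b) \<notin> R) as"
  by (auto simp: nz_path_def is_path_iff successively_conv_nth)

lemma arrow_ends: "a \<in> arrs Q \<Longrightarrow> src Q a \<in> verts Q \<and> tgt Q a \<in> verts Q"
  using finite_quiver by (simp add: finite_quiver_def)

lemma B_iff: "(v, as) \<in> B \<longleftrightarrow> v \<in> verts Q \<and> set as \<subseteq> arrs Q \<and>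
    (as \<noteq> [] \<longrightarrow> src Q (hd as) = v) \<and> successively (\<lambda>a b. tgt Q a = src Q b \<and> (a, b) \<notin> R) as"
  by (simp add: gbasis_def nz_path_iff)

lemma triangular_cycle: "is_path Q p \<Longrightarrow> snd p \<noteq> [] \<Longrightarrow> pnd p \<noteq> pstart p"
  using triangular unfolding triangular_def by blast

lemma path_distinct: "is_path Q (v, as) \<Longrightarrow> distinct as"
proof (rule ccontr)
  assume p: "is_path Q (v, as)" and "\<not> distinct as"
  then obtain xs ys zs a where as: "as = xs @ (a # ys) @ (a # zs)"
    using not_distinct_decomp by fastforce
  have "is_path Q (src Q a, a # ys)"
    using p arrow_ends unfolding as is_path_iff successively_append_iff by auto
  moreover have "pnd (src Q a, a # ys) = src Q a"
    using p unfolding as is_path_iff pend_def successively_append_iff by auto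
  ultimately show False using triangular_cycle by (force simp: pstart_def)
qed

text \<open>No path repeats an arrow, so lengths are bounded by the number of arrows and
  \<open>A\<close> is finite-dimensional. A \<open>sum\<close> over an infinite set would be 0, so
  all expansions over \<open>B\<close> rest on this.\<close>

lemma finite_B [simp]: "finite B"
proof (rule finite_subset)
  show "B \<subseteq> verts Q \<times> {as. set as \<subseteq> arrs Q \<and> length as \<le> card (arrs Q)}"
  proof
    fix p assume p: "p \<in> B"
    obtain v as where vas: "p = (v, as)" by fastforce
    have path: "is_path Q (v, as)" using p by (simp add: vas gbasis_def nz_path_def)
    have "length as = card (set as)"
      using path_distinct[OF path] by (simp add: distinct_card)
    also have "\<dots> \<le> card (arrs Q)"
      using path finite_quiver by (intro card_mono) (auto simp: is_path_iff finite_quiver_def)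
    finally show "p \<in> verts Q \<times> {as. set as \<subseteq> arrs Q \<and> length as \<le> card (arrs Q)}"
      using path by (auto simp: vas is_path_iff)
  qed
qed (use finite_quiver in \<open>simp add: finite_quiver_def finite_lists_length_le\<close>)

lemma pcat_assoc: "pcat (pcat p q) s = pcat p (pcat q s)"
  by (simp add: pcat_def)

lemma pstart_pcat [simp]: "pstart (pcat p q) = pstart p"
  by (simp add: pcat_def pstart_def)

lemma pend_pcat: "nzprod p q \<Longrightarrow> pnd (pcat p q) = pnd q"
  by (auto simp: nzprod_def pcat_def pstart_def pend_def)

lemma snd_pcat [simp]: "snd (pcat p q) = snd p @ snd q"
  by (simp add: pcat_def)

lemma pcat_in_B [intro, simp]: "nzprod p q \<Longrightarrow> pcat p q \<in> B"
  by (simp add: nzprod_def gbasis_def)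

lemma pend_triv [simp]: "pnd (triv v) = v" and pstart_triv [simp]: "pstart (triv v) = v"
  by (simp_all add: pend_def pstart_def)

lemma pstart_in: "p \<in> B \<Longrightarrow> pstart p \<in> verts Q"
  by (cases p) (simp add: B_iff pstart_def)

lemma pend_in: "p \<in> B \<Longrightarrow> pnd p \<in> verts Q"
  by (cases p) (auto simp: B_iff pend_def dest: last_in_set intro: arrow_ends[THEN conjunct2])

lemma triv_in_B [simp]: "triv v \<in> B \<longleftrightarrow> v \<in> verts Q"
  by (simp add: B_iff)

lemma nzprod_triv_left: "p \<in> B \<Longrightarrow> nzprod (triv v) p \<longleftrightarrow> pstart p = v"
  by (cases p) (auto simp: nzprod_def pcat_def pstart_def pend_def gbasis_def)

lemma nzprod_triv_right: "p \<in> B \<Longrightarrow> nzprod p (triv v) \<longleftrightarrow> pnd p = v"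
  by (cases p) (auto simp: nzprod_def pcat_def pstart_def gbasis_def)

lemma pcat_triv_left: "pstart p = v \<Longrightarrow> pcat (triv v) p = p"
  by (cases p) (simp add: pcat_def pstart_def)

lemma pcat_triv_right [simp]: "pcat p (triv v) = p"
  by (cases p) (simp add: pcat_def)

lemma nontrivial_pend: "snd p \<noteq> [] \<Longrightarrow> pnd p = tgt Q (last (snd p))"
  by (simp add: pend_def)

lemma nontrivial_pstart: "p \<in> B \<Longrightarrow> snd p \<noteq> [] \<Longrightarrow> pstart p = src Q (hd (snd p))"
  by (cases p) (simp add: B_iff pstart_def)

lemma nzprod_nontrivial:
  assumes "p \<in> B" "q \<in> B" "snd p \<noteq> []" "snd q \<noteq> []"
  shows "nzprod p q \<longleftrightarrow> pnd p = pstart q \<and> (last (snd p), hd (snd q)) \<notin> R"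
  using assms by (cases p; cases q)
    (auto simp: nzprod_def pcat_def nz_path_iff B_iff successively_append_iff pend_def pstart_def)

lemma not_nzprod_R:
  assumes "p \<in> B" "q \<in> B" "snd p \<noteq> []" "snd q \<noteq> []" "pnd p = pstart q" "\<not> nzprod p q"
  shows "(last (snd p), hd (snd q)) \<in> R"
  using assms by (simp add: nzprod_nontrivial)

text \<open>For nontrivial factors both sides say that the ends match and neither junction lies in
  \<open>R\<close>. A trivial factor has no arrow to test and is treated separately.\<close>

lemma nzprod_assoc:
  assumes "p \<in> B" "q \<in> B" "s \<in> B"
  shows "nzprod p q \<and> nzprod (pcat p q) s \<longleftrightarrow> nzprod q s \<and> nzprod p (pcat q s)"
proof (cases "snd p = [] \<or> snd q = [] \<or> snd s = []")
  case True
  then consider v where "p = triv v" | v where "q = triv v" | v where "s = triv v"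
    by (metis prod.collapse)
  then show ?thesis
  proof cases
    case 1
    then show ?thesis using assms by (auto simp: nzprod_triv_left pcat_triv_left)
  next
    case 2
    then show ?thesis using assms by (auto simp: nzprod_triv_left nzprod_triv_right pcat_triv_left nzprod_def gbasis_def)
  next
    case 3
    then show ?thesis using assms by (auto simp: nzprod_triv_right pend_pcat)
  qed
next
  case False
  then show ?thesis using assms
    by (auto simp: nzprod_nontrivial pend_pcat)
qed

text \<open>Here it matters that the relations have length two: only the last arrow of
  \<open>q\<close> decides about a further factor. For trivial \<open>q\<close> the equivalence can
  fail, as \<open>p\<close> and \<open>s\<close> then meet directly.\<close>

lemma nzprod_pcat_left:
  assumes "p \<in> B" "q \<in> B" "s \<in> B" "snd q \<noteq> []" "nzprod p q"
  shows "nzprod (pcat p q) s \<longleftrightarrow> nzprod q s"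
  using assms by (cases "snd s = []"; cases s) (auto simp: nzprod_nontrivial pend_pcat nzprod_triv_right)

lemma nzprod_pcat_right:
  assumes "p \<in> B" "q \<in> B" "s \<in> B" "snd q \<noteq> []" "nzprod q s"
  shows "nzprod p (pcat q s) \<longleftrightarrow> nzprod p q"
  using assms by (cases "snd p = []"; cases p) (auto simp: nzprod_nontrivial pend_pcat nzprod_triv_left)

definition head_arrow :: "('v,'a) path \<Rightarrow> ('v,'a) path" where "head_arrow p = (fst p, [hd (snd p)])"
definition tail_path :: "('v,'a) path \<Rightarrow> ('v,'a) path" where "tail_path p = (tgt Q (hd (snd p)), tl (snd p))"

lemma head_arrow_tail_path:
  assumes "p \<in> B" "snd p \<noteq> []"
  shows "head_arrow p \<in> B" "tail_path p \<in> B" "nzprod (head_arrow p) (tail_path p)" "pcat (head_arrow p) (tail_path p) = p" "snd (head_arrow p) \<noteq> []"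
proof -
  obtain v a as where p: "p = (v, a # as)" using assms(2) by (cases p) (auto simp: neq_Nil_conv)
  show "head_arrow p \<in> B" "tail_path p \<in> B" "pcat (head_arrow p) (tail_path p) = p" "snd (head_arrow p) \<noteq> []"
    using assms(1) arrow_ends by (auto simp: p head_arrow_def tail_path_def B_iff pcat_def successively_Cons)
  then show "nzprod (head_arrow p) (tail_path p)" using assms(1)
    by (simp add: nzprod_def p head_arrow_def tail_path_def pend_def pstart_def pcat_def gbasis_def)
qed

text \<open>The concatenated arrows form a path of \<open>Q\<close>, possibly one that is zero in
  \<open>A\<close>, so triangularity applies. This covers Koszul tuples, whose neighbouring products
  vanish.\<close>

lemma chain_not_closed:
  assumes "set ds \<subseteq> B" "successively (\<lambda>p q. pnd p = pstart q) ds" "ds \<noteq> []" "\<forall>p\<in>set ds. snd p \<noteq> []"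
  shows "pstart (hd ds) \<noteq> pnd (last ds)"
proof -
  have "is_path Q (pstart (hd ds), concat (map snd ds)) \<and> concat (map snd ds) \<noteq> [] \<and>
     pnd (pstart (hd ds), concat (map snd ds)) = pnd (last ds)"
    using assms
  proof (induction ds rule: induct_list012)
    case (2 p)
    then show ?case by (cases p) (auto simp: gbasis_def nz_path_def pstart_def)
  next
    case (3 p q ds)
    then have IH: "is_path Q (pstart q, concat (map snd (q # ds)))" "concat (map snd (q # ds)) \<noteq> []"
      "pnd (pstart q, concat (map snd (q # ds))) = pnd (last (q # ds))" by auto
    have p: "p \<in> B" "snd p \<noteq> []" "pnd p = pstart q" using 3 by auto
    have "is_path Q (pstart p, snd p @ concat (map snd (q # ds)))"
      using IH(1,2) p by (cases p) (auto simp: is_path_iff B_iff successively_append_iff pend_def pstart_def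
          intro: successively_mono)
    moreover have "pnd (pstart p, snd p @ xs) = pnd (pstart q, xs)" if "xs \<noteq> []" for xs
      using that by (simp add: pend_def)
    ultimately show ?case using IH p(2) by simp
  qed simp
  then show ?thesis using triangular_cycle by (metis pstart_def fst_conv snd_conv)
qed

subsection \<open>The Hochschild differential\<close>

definition lact :: "('v,'a) path \<Rightarrow> (('v,'a) path \<Rightarrow> 'k::field) \<Rightarrow> ('v,'a) path \<Rightarrow> 'k" where
  "lact p x r = (\<Sum>q\<in>B. if nzprod p q \<and> r = pcat p q then x q else 0)"

definition ract :: "(('v,'a) path \<Rightarrow> 'k::field) \<Rightarrow> ('v,'a) path \<Rightarrow> ('v,'a) path \<Rightarrow> 'k" where
  "ract x p r = (\<Sum>q\<in>B. if nzprod q p \<and> r = pcat q p then x q else 0)"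

lemma bprod_eq: "bprod Q R p q r = (if nzprod p q \<and> r = pcat p q then 1 else 0)"
  by (auto simp: bprod_def nzprod_def)

lemma amul_bvec_left: "p \<in> B \<Longrightarrow> amul Q R (bvec p) x r = lact p x r"
proof -
  assume "p \<in> B"
  have "amul Q R (bvec p) x r = (\<Sum>p'\<in>B. if p' = p then \<Sum>q\<in>B. x q * bprod Q R p q r else 0)"
    unfolding amul_def bvec_def by (rule sum.cong) auto
  then show ?thesis using \<open>p \<in> B\<close>
    by (simp add: lact_def bprod_eq if_distrib[of "(*) _"] cong: if_cong)
qed

lemma amul_bvec_right: "p \<in> B \<Longrightarrow> amul Q R x (bvec p) r = ract x p r"
proof -
  assume "p \<in> B"
  have "amul Q R x (bvec p) r = (\<Sum>q\<in>B. \<Sum>p'\<in>B. if p' = p then x q * bprod Q R q p r else 0)"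
    unfolding amul_def bvec_def by (intro sum.cong) auto
  then show ?thesis using \<open>p \<in> B\<close>
    by (simp add: ract_def bprod_eq if_distrib[of "(*) _"] cong: if_cong)
qed

lemma pcat_left_cancel: "nzprod p q \<Longrightarrow> nzprod p q' \<Longrightarrow> pcat p q = pcat p q' \<longleftrightarrow> q = q'"
  by (cases q; cases q') (auto simp: nzprod_def pcat_def pstart_def)

lemma pcat_right_cancel: "pcat q p = pcat q' p \<longleftrightarrow> q = q'"
  by (cases q; cases q') (auto simp: pcat_def)

lemma lact_pcat [simp]: "q \<in> B \<Longrightarrow> nzprod p q \<Longrightarrow> lact p x (pcat p q) = x q"
proof -
  assume "q \<in> B" "nzprod p q"
  then have "lact p x (pcat p q) = (\<Sum>q'\<in>B. if q' = q then x q else 0)"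
    unfolding lact_def by (intro sum.cong) (auto simp: pcat_left_cancel)
  then show ?thesis using \<open>q \<in> B\<close> by simp
qed

lemma ract_pcat [simp]: "q \<in> B \<Longrightarrow> nzprod q p \<Longrightarrow> ract x p (pcat q p) = x q"
proof -
  assume "q \<in> B" "nzprod q p"
  then have "ract x p (pcat q p) = (\<Sum>q'\<in>B. if q' = q then x q else 0)"
    unfolding ract_def by (intro sum.cong) (auto simp: pcat_right_cancel)
  then show ?thesis using \<open>q \<in> B\<close> by simp
qed

lemma lact_eq_0: "(\<And>q. q \<in> B \<Longrightarrow> nzprod p q \<Longrightarrow> r = pcat p q \<Longrightarrow> x q = 0) \<Longrightarrow> lact p x r = 0"
  unfolding lact_def by (rule sum.neutral) auto

lemma ract_eq_0: "(\<And>q. q \<in> B \<Longrightarrow> nzprod q p \<Longrightarrow> r = pcat q p \<Longrightarrow> x q = 0) \<Longrightarrow> ract x p r = 0"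
  unfolding ract_def by (rule sum.neutral) auto

lemma lact_zero [simp]: "lact p (\<lambda>_. 0) r = 0" and ract_zero [simp]: "ract (\<lambda>_. 0) p r = 0"
  by (auto intro: lact_eq_0 ract_eq_0)

text \<open>By cancellation at most one summand is nonzero, so the action reads a single coefficient
  of \<open>x\<close>. Linearity and the exchange with \<open>merges\<close> become immediate in
  this form.\<close>

lemma lact_eq_if: "lact p x r = (if \<exists>q\<in>B. nzprod p q \<and> r = pcat p q
    then x (THE q. q \<in> B \<and> nzprod p q \<and> r = pcat p q) else 0)"
proof (cases "\<exists>q\<in>B. nzprod p q \<and> r = pcat p q")
  case True
  then obtain q where q: "q \<in> B" "nzprod p q" "r = pcat p q" by blast
  then have "(THE q. q \<in> B \<and> nzprod p q \<and> r = pcat p q) = q"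
    by (intro the_equality) (auto simp: pcat_left_cancel)
  then show ?thesis using q by auto
qed (auto intro: lact_eq_0)

lemma ract_eq_if: "ract x p r = (if \<exists>q\<in>B. nzprod q p \<and> r = pcat q p
    then x (THE q. q \<in> B \<and> nzprod q p \<and> r = pcat q p) else 0)"
proof (cases "\<exists>q\<in>B. nzprod q p \<and> r = pcat q p")
  case True
  then obtain q where q: "q \<in> B" "nzprod q p" "r = pcat q p" by blast
  then have "(THE q. q \<in> B \<and> nzprod q p \<and> r = pcat q p) = q"
    by (intro the_equality) (auto simp: pcat_right_cancel)
  then show ?thesis using q by auto
qed (auto intro: ract_eq_0)

lemma lact_add: "lact p (\<lambda>r. x r + y r) r = lact p x r + lact p y r"
  and lact_diff: "lact p (\<lambda>r. x r - y r) r = lact p x r - lact p y r"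
  and lact_minus: "lact p (\<lambda>r. - x r) r = - lact p x r"
  and lact_scale: "lact p (\<lambda>r. c * x r) r = c * lact p x r"
  by (auto simp: lact_eq_if)

lemma ract_add: "ract (\<lambda>r. x r + y r) p r = ract x p r + ract y p r"
  and ract_diff: "ract (\<lambda>r. x r - y r) p r = ract x p r - ract y p r"
  and ract_minus: "ract (\<lambda>r. - x r) p r = - ract x p r"
  and ract_scale: "ract (\<lambda>r. c * x r) p r = c * ract x p r"
  by (auto simp: ract_eq_if)

lemma lact_outside: "r \<notin> B \<Longrightarrow> lact p x r = 0" and ract_outside: "r \<notin> B \<Longrightarrow> ract x p r = 0"
  by (auto intro: lact_eq_0 ract_eq_0)

lemma lact_triv: "r \<in> B \<Longrightarrow> lact (triv v) x r = (if pstart r = v then x r else 0)"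
  using lact_pcat[of r "triv v" x] by (auto simp: nzprod_triv_left pcat_triv_left intro!: lact_eq_0)

lemma ract_triv: "r \<in> B \<Longrightarrow> ract x (triv v) r = (if pnd r = v then x r else 0)"
  using ract_pcat[of r "triv v" x] by (auto simp: nzprod_triv_right intro!: ract_eq_0)

lemma lact_lact:
  assumes "p \<in> B" "q \<in> B"
  shows "lact p (\<lambda>r. lact q x r) r = (if nzprod p q then lact (pcat p q) x r else 0)"
proof (cases "\<exists>s\<in>B. nzprod q s \<and> nzprod p (pcat q s) \<and> r = pcat p (pcat q s)")
  case True
  then obtain s where s: "s \<in> B" "nzprod q s" "nzprod p (pcat q s)" "r = pcat (pcat p q) s"
    by (auto simp: pcat_assoc)
  moreover have "nzprod p q \<and> nzprod (pcat p q) s" using s assms nzprod_assoc by blast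
  ultimately show ?thesis by simp (simp add: pcat_assoc)
next
  case False
  have "lact p (\<lambda>r. lact q x r) r = 0"
    using False by (intro lact_eq_0) blast
  moreover have "lact (pcat p q) x r = 0" if "nzprod p q"
    using False that assms nzprod_assoc by (intro lact_eq_0) (metis pcat_assoc)
  ultimately show ?thesis by simp
qed

lemma ract_ract:
  assumes "p \<in> B" "q \<in> B"
  shows "ract (\<lambda>r. ract x p r) q r = (if nzprod p q then ract x (pcat p q) r else 0)"
proof (cases "\<exists>s\<in>B. nzprod s p \<and> nzprod (pcat s p) q \<and> r = pcat (pcat s p) q")
  case True
  then obtain s where s: "s \<in> B" "nzprod s p" "nzprod (pcat s p) q" "r = pcat (pcat s p) q"
    by auto
  moreover have "nzprod p q \<and> nzprod s (pcat p q)" using s assms nzprod_assoc by blast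
  ultimately show ?thesis by simp (simp add: pcat_assoc)
next
  case False
  have "ract (\<lambda>r. ract x p r) q r = 0"
    using False by (intro ract_eq_0) blast
  moreover have "ract x (pcat p q) r = 0" if "nzprod p q"
    using False that assms nzprod_assoc by (intro ract_eq_0) (metis pcat_assoc)
  ultimately show ?thesis by simp
qed

lemma lact_ract:
  assumes "p \<in> B" "q \<in> B"
  shows "lact p (\<lambda>r. ract x q r) r = ract (\<lambda>r. lact p x r) q r"
proof (cases "\<exists>s\<in>B. nzprod p s \<and> nzprod (pcat p s) q \<and> r = pcat (pcat p s) q")
  case True
  then obtain s where s: "s \<in> B" "nzprod p s" "nzprod (pcat p s) q" "r = pcat (pcat p s) q"
    by auto
  moreover have "nzprod s q \<and> nzprod p (pcat s q)" using s assms nzprod_assoc by blast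
  ultimately show ?thesis by simp (simp add: pcat_assoc)
next
  case False
  have "lact p (\<lambda>r. ract x q r) r = 0"
    using False assms nzprod_assoc by (intro lact_eq_0 ract_eq_0) (metis pcat_assoc)
  moreover have "ract (\<lambda>r. lact p x r) q r = 0"
    using False by (intro lact_eq_0 ract_eq_0) blast
  ultimately show ?thesis by simp
qed

text \<open>The inner terms of the Hochschild differential: the first merge has sign -1, and passing
  an entry flips the sign. The argument is scalar-valued so that a prefix can be absorbed into
  \<open>F\<close>.\<close>

fun merges :: "(('v,'a) path list \<Rightarrow> 'k::field) \<Rightarrow> ('v,'a) path list \<Rightarrow> 'k" where
  "merges F (a # b # ys) = - (if nzprod a b then F (pcat a b # ys) else 0) - merges (\<lambda>z. F (a # z)) (b # ys)"
| "merges F bs = 0"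

lemma merges_zero [simp]: "merges (\<lambda>z. 0) bs = 0"
  by (induction bs rule: induct_list012) auto

lemma merges_add: "merges (\<lambda>z. F z + G z) bs = merges F bs + merges G bs"
  by (induction bs arbitrary: F G rule: induct_list012) auto

lemma merges_scale: "merges (\<lambda>z. c * F z) bs = c * merges F bs"
  by (induction bs arbitrary: F rule: induct_list012) (auto simp: algebra_simps)

lemma merges_diff: "merges (\<lambda>z. F z - G z) bs = merges F bs - merges G bs"
  by (induction bs arbitrary: F G rule: induct_list012) auto

lemma merges_minus: "merges (\<lambda>z. - F z) bs = - merges F bs"
  using merges_scale[of "-1" F bs] by simp

lemma merges_cong:
  assumes "\<And>xs a b ys. bs = xs @ a # b # ys \<Longrightarrow> nzprod a b \<Longrightarrow> F (xs @ pcat a b # ys) = G (xs @ pcat a b # ys)"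
  shows "merges F bs = merges G bs"
  using assms
proof (induction F bs arbitrary: G rule: merges.induct)
  case (1 F a b ys)
  have "merges (\<lambda>z. F (a # z)) (b # ys) = merges (\<lambda>z. G (a # z)) (b # ys)"
    by (rule 1(1)) (use 1(2)[of "a # _"] in auto)
  then show ?case using 1(2)[of "[]"] by simp
qed auto

lemma merges_eq_0:
  assumes "\<And>xs a b ys. bs = xs @ a # b # ys \<Longrightarrow> nzprod a b \<Longrightarrow> F (xs @ pcat a b # ys) = 0"
  shows "merges F bs = 0"
  using merges_cong[of bs F "\<lambda>_. 0"] assms by simp

text \<open>The entry \<open>a\<close> occurs in both summands: merges ending at \<open>a\<close>
  belong to the first, merges starting at \<open>a\<close> to the second. Cocycle identities are
  examined around one position in this way.\<close>

lemma merges_append: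
  "merges F (xs @ a # ys) = merges (\<lambda>z. F (z @ ys)) (xs @ [a]) + (-1) ^ length xs * merges (\<lambda>z. F (xs @ z)) (a # ys)"
proof (induction xs arbitrary: F)
  case (Cons x xs)
  then show ?case using Cons.IH[of "\<lambda>z. F (x # z)"] by (cases xs) auto
qed simp

lemma lact_merges: "lact p (\<lambda>r. merges (\<lambda>z. c z r) bs) r = merges (\<lambda>z. lact p (c z) r) bs"
  by (cases "\<exists>q\<in>B. nzprod p q \<and> r = pcat p q") (simp_all only: lact_eq_if if_True if_False merges_zero)

lemma ract_merges: "ract (\<lambda>r. merges (\<lambda>z. c z r) bs) p r = merges (\<lambda>z. ract (c z) p r) bs"
  by (cases "\<exists>q\<in>B. nzprod q p \<and> r = pcat q p") (simp_all only: ract_eq_if if_True if_False merges_zero)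

text \<open>Merges at separate places cancel by their signs; overlapping ones act on three
  consecutive entries and cancel by associativity.\<close>

lemma merges_merges: "set bs \<subseteq> B \<Longrightarrow> merges (merges F) bs = 0"
proof (induction F bs rule: merges.induct)
  case (1 F a b ys)
  have IH: "merges (merges (\<lambda>z. F (a # z))) (b # ys) = 0" using 1 by simp
  show ?case
  proof (cases ys)
    case (Cons c zs)
    \<comment> \<open>A merge inside \<open>b # ys\<close> leaves a nonempty list, so the outer
      \<open>merges F\<close> can be unfolded at its head.\<close>
    have "merges (\<lambda>z. merges F (a # z)) (b # ys) =
        merges (\<lambda>z. - (if nzprod a (hd z) then F (pcat a (hd z) # tl z) else 0) - merges (\<lambda>z. F (a # z)) z) (b # ys)"
    proof (rule merges_cong, goal_cases)
      case (1 xs a' b' zs)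
      then show ?case by (cases xs) auto
    qed
    also have "\<dots> = - merges (\<lambda>z. if nzprod a (hd z) then F (pcat a (hd z) # tl z) else 0) (b # ys)"
      using IH by (simp add: merges_diff merges_minus)
    finally have "merges (merges F) (a # b # ys) = - (if nzprod a b then merges F (pcat a b # ys) else 0) +
        merges (\<lambda>z. if nzprod a (hd z) then F (pcat a (hd z) # tl z) else 0) (b # ys)" by simp
    moreover have "nzprod a b \<and> nzprod (pcat a b) c \<longleftrightarrow> nzprod b c \<and> nzprod a (pcat b c)"
      using 1(2) Cons by (intro nzprod_assoc) auto
    ultimately show ?thesis by (auto simp: Cons pcat_assoc)
  qed simp
qed auto

definition hdif :: "nat \<Rightarrow> ('v,'a,'k::field) cochain \<Rightarrow> ('v,'a,'k) cochain" where
  "hdif n c bs r = lact (hd bs) (c (tl bs)) r + merges (\<lambda>z. c z r) bs +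
     (-1) ^ Suc n * ract (c (butlast bs)) (last bs) r"

lemma merges_sum: "length bs = Suc n \<Longrightarrow> merges F bs = (\<Sum>i<n. (-1) ^ Suc i *
   (if nzprod (bs ! i) (bs ! Suc i) then F (take i bs @ pcat (bs ! i) (bs ! Suc i) # drop (Suc (Suc i)) bs) else 0))"
proof (induction F bs arbitrary: n rule: merges.induct)
  case (1 F a b ys)
  then obtain m where n: "n = Suc m" by (cases n) auto
  show ?case using 1(1)[of m] 1(2)
    by (simp add: n sum.lessThan_Suc_shift sum_negf[symmetric] if_distrib[of "(*) _"] if_distrib[of uminus]
        del: sum.lessThan_Suc cong: if_cong)
qed auto

lemma hdiff_eq_hdif:
  assumes "length bs = Suc n" "set bs \<subseteq> B"
  shows "hdiff Q R n c bs r = hdif n c bs r"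
proof -
  have [simp]: "hd bs \<in> B" "last bs \<in> B" "bs \<noteq> []"
    using assms last_in_set[of bs] by (cases bs; auto)+
  have "(\<Sum>i\<in>{1..n}. (-1) ^ i * (\<Sum>b\<in>B. bprod Q R (bs ! (i - 1)) (bs ! i) b *
          c (take (i - 1) bs @ [b] @ drop (i + 1) bs) r)) = 
     (\<Sum>i<n. (-1) ^ Suc i * (\<Sum>b\<in>B. bprod Q R (bs ! i) (bs ! Suc i) b *
          c (take i bs @ [b] @ drop (Suc (Suc i)) bs) r))"
    by (simp add: sum.atLeast1_atMost_eq)
  also have "\<dots> = merges (\<lambda>z. c z r) bs"
  proof (subst merges_sum[OF assms(1)], rule sum.cong[OF refl], goal_cases)
    case (1 i)
    let ?p = "pcat (bs ! i) (bs ! Suc i)"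
    have "(\<Sum>b\<in>B. bprod Q R (bs ! i) (bs ! Suc i) b * c (take i bs @ [b] @ drop (Suc (Suc i)) bs) r) =
      (\<Sum>b\<in>B. if b = ?p then (if nzprod (bs ! i) (bs ! Suc i) then c (take i bs @ ?p # drop (Suc (Suc i)) bs) r else 0) else 0)"
      by (rule sum.cong) (auto simp: bprod_eq)
    then show ?case by auto
  qed
  moreover have "take n bs = butlast bs" "bs ! n = last bs" "bs ! 0 = hd bs"
    using assms by (simp_all add: butlast_conv_take last_conv_nth hd_conv_nth)
  ultimately show ?thesis
    by (simp add: hdiff_def hdif_def amul_bvec_left amul_bvec_right)
qed

lemma hdif_add: "hdif n (\<lambda>z r. c z r + d z r) bs r = hdif n c bs r + hdif n d bs r"
  by (simp add: hdif_def lact_add ract_add merges_add algebra_simps)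

lemma hdif_diff: "hdif n (\<lambda>z r. c z r - d z r) bs r = hdif n c bs r - hdif n d bs r"
  by (simp add: hdif_def lact_diff ract_diff merges_diff algebra_simps)

lemma hdif_scale: "hdif n (\<lambda>z r. x * c z r) bs r = x * hdif n c bs r"
  by (simp add: hdif_def lact_scale ract_scale merges_scale algebra_simps)

text \<open>Pure merges cancel by \<open>merges_merges\<close>. A repeated left or right action
  cancels against the merge of the two outermost entries, and the mixed terms cancel because both
  actions commute.\<close>

lemma hdif_hdif:
  assumes "length bs = Suc (Suc n)" "set bs \<subseteq> B"
  shows "hdif (Suc n) (hdif n c) bs r = 0"
proof -
  let ?L = "\<lambda>z r. lact (hd z) (c (tl z)) r" and ?M = "\<lambda>z r. merges (\<lambda>z. c z r) z"
    and ?R = "\<lambda>z r. ract (c (butlast z)) (last z) r"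
  obtain a b ys where ab: "bs = a # b # ys" using assms(1) by (auto simp: length_Suc_conv)
  obtain xs y z where yz: "bs = xs @ [y, z]" and xs: "length xs = n"
    using assms(1) by (auto simp: length_Suc_conv_rev)
  have ab_in: "a \<in> B" "b \<in> B" using assms(2) by (auto simp: ab)
  have yz_in: "y \<in> B" "z \<in> B" using assms(2) by (auto simp: yz)
  note inB = ab_in yz_in
  have L: "merges (\<lambda>z. ?L z r) bs = - lact a (?L (tl bs)) r - lact a (?M (tl bs)) r"
    using inB by (simp add: ab lact_lact lact_merges)
  have R: "merges (\<lambda>z. ?R z r) bs = ract (?M (butlast bs)) z r - (-1) ^ n * ract (?R (butlast bs)) z r"
  proof -
    have "merges (\<lambda>z. ?R z r) bs = merges (\<lambda>w. ?R (w @ [z]) r) (xs @ [y]) + (-1) ^ n * merges (\<lambda>w. ?R (xs @ w) r) [y, z]"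
      using merges_append[of "\<lambda>z. ?R z r" xs y "[z]"] by (simp add: yz xs)
    then show ?thesis using inB by (simp add: yz ract_ract ract_merges butlast_append)
  qed
  have "hdif (Suc n) (hdif n c) bs r = lact a (hdif n c (tl bs)) r + merges (\<lambda>z. hdif n c z r) bs +
      (-1) ^ n * ract (hdif n c (butlast bs)) z r"
  proof -
    have "hd bs = a" "last bs = z" by (simp add: ab) (simp add: yz)
    then show ?thesis by (simp add: hdif_def[of "Suc n" "hdif n c"])
  qed
  also have "lact a (hdif n c (tl bs)) r = lact a (?L (tl bs)) r + lact a (?M (tl bs)) r -
      (-1) ^ n * lact a (?R (tl bs)) r"
    by (simp add: hdif_def[abs_def] lact_add lact_diff lact_scale lact_minus)
  also have "ract (hdif n c (butlast bs)) z r = ract (?L (butlast bs)) z r + ract (?M (butlast bs)) z r -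
      (-1) ^ n * ract (?R (butlast bs)) z r"
    by (simp add: hdif_def[abs_def] ract_add ract_diff ract_scale ract_minus)
  also have "merges (\<lambda>z. hdif n c z r) bs = merges (\<lambda>z. ?L z r) bs - (-1) ^ n * merges (\<lambda>z. ?R z r) bs"
    using merges_merges[OF assms(2), of "\<lambda>z. c z r"]
    by (simp add: hdif_def[abs_def] merges_add merges_diff merges_scale merges_minus)
  also have "lact a (?R (tl bs)) r = ract (?L (butlast bs)) z r"
  proof -
    have "butlast (tl bs) = tl (butlast bs)" by (simp add: butlast_tl)
    moreover have "last (tl bs) = z" by (cases xs) (simp_all add: yz)
    moreover have "hd (butlast bs) = a" by (simp add: ab)
    ultimately show ?thesis using inB by (simp add: lact_ract)
  qed
  finally show ?thesis unfolding L R
    by (simp add: algebra_simps flip: power_mult_distrib power_add)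
qed

subsection \<open>Normalisation at the vertices\<close>

lemma cocycle_hdif: "cocycle Q R n c \<Longrightarrow> length bs = Suc n \<Longrightarrow> set bs \<subseteq> B \<Longrightarrow> hdif n c bs r = 0"
  by (simp add: cocycle_def hdiff_eq_hdif)

lemma cochain_outside: "is_cochain Q R n c \<Longrightarrow> length bs = n \<Longrightarrow> set bs \<subseteq> B \<Longrightarrow> r \<notin> B \<Longrightarrow> c bs r = 0"
  by (simp add: is_cochain_def)

lemma cocycle_cochain: "cocycle Q R n c \<Longrightarrow> is_cochain Q R n c"
  by (simp add: cocycle_def)

lemma is_cochain_hdif:
  assumes "is_cochain Q R n h" shows "is_cochain Q R (Suc n) (hdif n h)"
  unfolding is_cochain_def
proof (intro allI impI, elim conjE)
  fix bs :: "('v,'a) path list" and r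
  assume *: "length bs = Suc n" "set bs \<subseteq> B" "r \<notin> B"
  then have "merges (\<lambda>z. h z r) bs = 0"
    by (intro merges_eq_0 cochain_outside[OF assms]) auto
  then show "hdif n h bs r = 0"
    using * by (simp add: hdif_def lact_outside ract_outside)
qed

lemma cocycle_diff_hdif:
  assumes "cocycle Q R (Suc n) c" "is_cochain Q R n h"
  shows "cocycle Q R (Suc n) (\<lambda>z r. c z r - hdif n h z r)"
  using assms(1) is_cochain_hdif[OF assms(2)]
  by (auto simp: cocycle_def hdiff_eq_hdif hdif_diff hdif_hdif is_cochain_def)

text \<open>Normalisation proceeds from left to right; \<open>j\<close> counts the positions already treated.\<close>

definition unital :: "nat \<Rightarrow> nat \<Rightarrow> ('v,'a,'k::field) cochain \<Rightarrow> bool" where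
  "unital j n c \<longleftrightarrow> (\<forall>xs v ys r. length (xs @ triv v # ys) = n \<longrightarrow> set (xs @ triv v # ys) \<subseteq> B \<longrightarrow>
     length xs < j \<longrightarrow> c (xs @ triv v # ys) r = 0)"

text \<open>The last clause, on the end point of the value, only becomes active for \<open>j = n + 1\<close>.\<close>

definition balanced :: "nat \<Rightarrow> nat \<Rightarrow> ('v,'a,'k::field) cochain \<Rightarrow> bool" where
  "balanced j n c \<longleftrightarrow> unital j n c \<and>
     (\<forall>xs a b ys r. length (xs @ a # b # ys) = n \<longrightarrow> set (xs @ a # b # ys) \<subseteq> B \<longrightarrow>
        Suc (length xs) < j \<longrightarrow> pnd a \<noteq> pstart b \<longrightarrow> c (xs @ a # b # ys) r = 0) \<and>
     (\<forall>b ys r. length (b # ys) = n \<longrightarrow> set (b # ys) \<subseteq> B \<longrightarrow> 0 < j \<longrightarrow> pstart r \<noteq> pstart b \<longrightarrow> c (b # ys) r = 0) \<and>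
     (\<forall>xs b r. length (xs @ [b]) = n \<longrightarrow> set (xs @ [b]) \<subseteq> B \<longrightarrow> n < j \<longrightarrow> pnd r \<noteq> pnd b \<longrightarrow> c (xs @ [b]) r = 0)"

lemma unitalD: "unital j n c \<Longrightarrow> length (xs @ triv v # ys) = n \<Longrightarrow> set (xs @ triv v # ys) \<subseteq> B \<Longrightarrow>
     length xs < j \<Longrightarrow> c (xs @ triv v # ys) r = 0"
  by (simp add: unital_def)

lemma balancedD:
  assumes "balanced j n c"
  shows "unital j n c"
    "length (xs @ a # b # ys) = n \<Longrightarrow> set (xs @ a # b # ys) \<subseteq> B \<Longrightarrow>
        Suc (length xs) < j \<Longrightarrow> pnd a \<noteq> pstart b \<Longrightarrow> c (xs @ a # b # ys) r = 0"
    "length (b # ys) = n \<Longrightarrow> set (b # ys) \<subseteq> B \<Longrightarrow> 0 < j \<Longrightarrow> pstart r \<noteq> pstart b \<Longrightarrow> c (b # ys) r = 0"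
    "length (xs @ [b]) = n \<Longrightarrow> set (xs @ [b]) \<subseteq> B \<Longrightarrow> n < j \<Longrightarrow> pnd r \<noteq> pnd b \<Longrightarrow> c (xs @ [b]) r = 0"
  using assms by (simp_all add: balanced_def)

lemma merges_triv_left:
  assumes "unital j n c" "length (xs @ a # triv v # ys) = Suc n" "set (xs @ a # triv v # ys) \<subseteq> B" "length xs < j"
  shows "merges (\<lambda>z. c (z @ triv v # ys) r) (xs @ [a]) = 0"
proof (rule merges_eq_0, goal_cases)
  case (1 xs' a' b' ys')
  then have "length xs = Suc (length xs' + length ys')"
    by (metis add_Suc_right length_append_singleton length_Cons length_append nat.inject)
  moreover have "set (xs' @ a' # b' # ys') \<subseteq> B" unfolding 1(1)[symmetric] using assms(3) by auto
  ultimately show ?case using assms 1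
    using unitalD[of j n c "xs' @ pcat a' b' # ys'" v ys r] by auto
qed

lemma merges_triv_right:
  assumes "unital j n c" "length (xs @ triv v # ys) = Suc n" "set (xs @ triv v # ys) \<subseteq> B" "length xs < j"
  shows "merges (\<lambda>z. c (xs @ triv v # z) r) ys = 0"
  using assms by (intro merges_eq_0 unitalD) auto

lemma ract_triv_right:
  assumes "unital j n c" "length (xs @ triv v # b # ys) = Suc n" "set (xs @ triv v # b # ys) \<subseteq> B" "length xs < j"
  shows "ract (c (xs @ triv v # butlast (b # ys))) p r = 0"
proof (rule ract_eq_0)
  show "c (xs @ triv v # butlast (b # ys)) q = 0" for q
    using assms by (intro unitalD[OF assms(1)]) (auto dest: in_set_butlastD split: if_splits)
qed

lemma lact_triv_tl:
  assumes "unital j n c" "length (xs @ a # triv v # ys) = Suc n" "set (xs @ a # triv v # ys) \<subseteq> B" "length xs < j"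
  shows "lact p (c (tl (xs @ a # triv v # ys))) r = 0"
proof (rule lact_eq_0)
  show "c (tl (xs @ a # triv v # ys)) q = 0" for q
    using assms unitalD[OF assms(1), of "tl (xs @ [a])" v ys q] by (cases xs) auto
qed

text \<open>The cocycle identity is applied to the list with a trivial path inserted at the end of
  \<open>a\<close>, or at the start or end vertex of \<open>r\<close>; if the vertices do not match,
  unitality leaves a single term. Once \<open>n \<le> j\<close> all arguments are treated, and the
  clause on end points becomes available at index \<open>Suc n\<close>.\<close>

lemma balanced_of_unital:
  assumes c: "cocycle Q R n c" and u: "unital j n c"
  shows "balanced (if n \<le> j then Suc n else j) n c"
proof -
  have comp: "c (xs @ a # b # ys) r = 0"
    if *: "length (xs @ a # b # ys) = n" "set (xs @ a # b # ys) \<subseteq> B" "Suc (length xs) < j" "pnd a \<noteq> pstart b"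
    for xs a b ys r
  proof -
    define v where "v = pnd a"
    have inB: "triv v \<in> B" "a \<in> B" "b \<in> B" using * pend_in[of a] by (auto simp: v_def)
    have len: "length (xs @ a # triv v # b # ys) = Suc n" and sub: "set (xs @ a # triv v # b # ys) \<subseteq> B"
      using * inB by auto
    let ?bs = "xs @ a # triv v # b # ys"
    have "hdif n c ?bs r = 0" by (rule cocycle_hdif[OF c len sub])
    moreover have "lact (hd ?bs) (c (tl ?bs)) r = 0"
      by (rule lact_triv_tl[OF u len sub]) (use * in simp)
    moreover have "ract (c (butlast ?bs)) (last ?bs) r = 0"
      using ract_triv_right[OF u, of "xs @ [a]" v b ys] len sub * by (simp add: butlast_append)
    moreover have "merges (\<lambda>z. c z r) ?bs = (-1) ^ length xs * - c (xs @ a # b # ys) r"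
      using merges_triv_left[OF u len sub] merges_triv_right[OF u, of "xs @ [a]" v "b # ys" r] inB * len sub
      by (subst merges_append) (simp add: nzprod_triv_left nzprod_triv_right v_def)
    ultimately show ?thesis by (simp add: hdif_def)
  qed
  have start: "c (b # ys) r = 0"
    if *: "length (b # ys) = n" "set (b # ys) \<subseteq> B" "0 < j" "pstart r \<noteq> pstart b" for b ys r
  proof (cases "r \<in> B")
    case True
    define v where "v = pstart r"
    have inB: "triv v \<in> B" "b \<in> B" using * pstart_in[OF True] by (auto simp: v_def)
    have "hdif n c (triv v # b # ys) r = 0" by (rule cocycle_hdif[OF c]) (use * inB in auto)
    moreover have "merges (\<lambda>z. c (triv v # z) r) (b # ys) = 0"
      using merges_triv_right[OF u, of "[]" v "b # ys" r] inB * by simp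
    moreover have "ract (c (triv v # butlast (b # ys))) (last (b # ys)) r = 0"
      using ract_triv_right[OF u, of "[]" v b ys] inB * by simp
    ultimately show ?thesis using True * inB
      by (simp add: hdif_def lact_triv nzprod_triv_left) (simp add: v_def)
  qed (use * cochain_outside[OF cocycle_cochain[OF c]] in blast)
  have finish: "c (xs @ [b]) r = 0"
    if *: "length (xs @ [b]) = n" "set (xs @ [b]) \<subseteq> B" "n \<le> j" "pnd r \<noteq> pnd b" for xs b r
  proof (cases "r \<in> B")
    case True
    define v where "v = pnd r"
    have inB: "triv v \<in> B" "b \<in> B" using * pend_in[OF True] by (auto simp: v_def)
    have len: "length (xs @ b # triv v # []) = Suc n" and sub: "set (xs @ b # triv v # []) \<subseteq> B"
      using * inB by auto
    let ?bs = "xs @ b # triv v # []"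
    have "hdif n c ?bs r = 0" by (rule cocycle_hdif[OF c len sub])
    moreover have "lact (hd ?bs) (c (tl ?bs)) r = 0"
      by (rule lact_triv_tl[OF u len sub]) (use * in simp)
    moreover have "merges (\<lambda>z. c z r) ?bs = 0"
      using merges_triv_left[OF u len sub] inB * len sub
      by (subst merges_append) (auto simp: nzprod_triv_right v_def)
    moreover have "ract (c (butlast ?bs)) (last ?bs) r = c (xs @ [b]) r"
      using True by (simp add: butlast_append ract_triv v_def)
    ultimately show ?thesis by (simp add: hdif_def)
  qed (use * cochain_outside[OF cocycle_cochain[OF c]] in blast)
  have "unital (if n \<le> j then Suc n else j) n c"
    using u by (auto simp: unital_def)
  moreover have "Suc (length xs) < j" if "Suc (length xs) < (if n \<le> j then Suc n else j)"
      "length (xs @ a # b # ys) = n" for xs a b and ys :: "('v,'a) path list"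
    using that by (auto split: if_splits)
  moreover have "0 < j" if "0 < (if n \<le> j then Suc n else j)" "length (b # ys) = n" for b and ys :: "('v,'a) path list"
    using that by (auto split: if_splits)
  moreover have "n \<le> j" if "n < (if n \<le> j then Suc n else j)"
    using that by (auto split: if_splits)
  ultimately show ?thesis
    unfolding balanced_def using comp start finish by blast
qed

text \<open>Ensures that a correction does not spoil positions already treated. The merges of
  \<open>triv v\<close> with its two neighbours (at an end, one of them is replaced by the outer
  action) have opposite signs and cancel if the vertices match; otherwise balancedness makes the
  value of \<open>h\<close> vanish. For \<open>n = 0\<close> the commutator with
  \<open>triv v\<close> may be nonzero.\<close>

lemma unital_hdif:
  assumes h: "balanced j n h" and ch: "is_cochain Q R n h" and "0 < n"
  shows "unital j (Suc n) (hdif n h)"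
  unfolding unital_def
proof (intro allI impI)
  fix xs v ys r
  assume len: "length (xs @ triv v # ys) = Suc n" and sub: "set (xs @ triv v # ys) \<subseteq> B" and j: "length xs < j"
  note u = balancedD(1)[OF h]
  let ?bs = "xs @ triv v # ys"
  have v: "triv v \<in> B" using sub by auto
  show "hdif n h ?bs r = 0"
  proof (cases "r \<in> B")
    case r: True
    show ?thesis
    proof (cases xs rule: rev_cases)
      case Nil
      then obtain y ys' where ys: "ys = y # ys'" using len \<open>0 < n\<close> by (cases ys) auto
      have y: "y \<in> B" using sub ys by auto
      have "merges (\<lambda>z. h (triv v # z) r) ys = 0"
        using merges_triv_right[OF u, of "[]" v ys r] len sub j Nil by simp
      moreover have "ract (h (triv v # butlast (y # ys'))) (last (y # ys')) r = 0"
        using ract_triv_right[OF u, of "[]" v y ys'] len sub j Nil ys by simp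
      moreover have "h ys r = 0" if "pstart r \<noteq> pstart y"
        using balancedD(3)[OF h, of y ys' r] len sub j Nil ys that by auto
      ultimately show ?thesis using r y by (auto simp: Nil ys hdif_def lact_triv nzprod_triv_left pcat_triv_left)
    next
      case (snoc xs0 x)
      have x: "x \<in> B" using sub snoc by auto
      have bs: "?bs = xs0 @ x # triv v # ys" by (simp add: snoc)
      have l: "lact (hd ?bs) (h (tl ?bs)) r = 0"
        unfolding bs by (rule lact_triv_tl[OF u]) (use len sub j snoc in auto)
      have m: "merges (\<lambda>z. h (z @ triv v # ys) r) (xs0 @ [x]) = 0"
        by (rule merges_triv_left[OF u]) (use len sub j snoc in auto)
      show ?thesis
      proof (cases ys)
        case Nil
        have "h xs r = 0" if "pnd r \<noteq> pnd x"
          using balancedD(4)[OF h, of xs0 x r] len sub j Nil snoc that by auto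
        moreover have "merges (\<lambda>z. h z r) ?bs = (-1) ^ length xs0 * - (if pnd x = v then h xs r else 0)"
          using m x unfolding bs by (subst merges_append) (auto simp: Nil nzprod_triv_right snoc)
        moreover have "ract (h (butlast ?bs)) (last ?bs) r = (if pnd r = v then h xs r else 0)"
          using r by (simp add: Nil ract_triv butlast_append)
        moreover have "n = Suc (length xs0)" using len snoc Nil by simp
        ultimately show ?thesis using l by (auto simp: hdif_def)
      next
        case (Cons y ys')
        have y: "y \<in> B" using sub Cons by auto
        have "h (xs @ ys) r = 0" if "pnd x \<noteq> pstart y"
          using balancedD(2)[OF h, of xs0 x y ys'] len sub j Cons snoc that by auto
        moreover have "merges (\<lambda>z. h (xs @ triv v # z) r) ys = 0"
          by (rule merges_triv_right[OF u]) (use len sub j in auto)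
        moreover have "ract (h (xs @ triv v # butlast (y # ys'))) (last (y # ys')) r = 0"
          by (rule ract_triv_right[OF u]) (use len sub j Cons in auto)
        then have "ract (h (butlast ?bs)) (last ?bs) r = 0" by (simp add: Cons butlast_append)
        moreover have "merges (\<lambda>z. h z r) ?bs = merges (\<lambda>z. h (z @ triv v # ys) r) (xs0 @ [x]) + (-1) ^ length xs0 *
          (- (if pnd x = v then h (xs @ ys) r else 0) -
           (- (if pstart y = v then h (xs @ ys) r else 0) - merges (\<lambda>z. h (xs @ triv v # z) r) ys))"
          using x y v unfolding bs by (subst merges_append)
            (simp add: Cons nzprod_triv_right nzprod_triv_left snoc pcat_triv_left)
        ultimately show ?thesis using l m by (auto simp: hdif_def)
      qed
    qed
  qed (rule cochain_outside[OF is_cochain_hdif[OF ch] len sub])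
qed

text \<open>Position 0 has no left neighbour to supply a vertex, so the homotopy takes it from the
  value: \<open>?h z r\<close> is the coefficient at \<open>r\<close> of the sum of
  \<open>e_v c(e_v, z)\<close> over all vertices \<open>v\<close>.\<close>

lemma unital_step_0:
  assumes c: "cocycle Q R (Suc n) c"
  obtains h where "is_cochain Q R n h" "unital 1 (Suc n) (\<lambda>z r. c z r - hdif n h z r)"
proof
  let ?h = "\<lambda>z r. if r \<in> B then c (triv (pstart r) # z) r else 0"
  show "is_cochain Q R n ?h" by (simp add: is_cochain_def)
  show "unital 1 (Suc n) (\<lambda>z r. c z r - hdif n ?h z r)"
    unfolding unital_def
  proof (intro allI impI)
    fix xs v and ys :: "('v,'a) path list" and r
    assume len: "length (xs @ triv v # ys) = Suc n" and sub: "set (xs @ triv v # ys) \<subseteq> B" and "length xs < 1"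
    then have xs: "xs = []" by simp
    show "c (xs @ triv v # ys) r - hdif n ?h (xs @ triv v # ys) r = 0"
    proof (cases "r \<in> B")
      case r: True
      define w where "w = pstart r"
      have w: "triv w \<in> B" using pstart_in[OF r] by (simp add: w_def)
      have "ract (?h z) p r = ract (c (triv w # z)) p r" for z p
      proof -
        have "?h z q = c (triv w # z) q" if "q \<in> B" "r = pcat q p" for q
          using that by (simp add: w_def)
        then show ?thesis unfolding ract_def by (intro sum.cong) auto
      qed
      note ract_h = this
      define bs where "bs = triv v # ys"
      have bs: "hd bs = triv v" "tl bs = ys" "bs \<noteq> []" "length bs = Suc n" "set bs \<subseteq> B"
        using len sub xs by (auto simp: bs_def)
      let ?T = "merges (\<lambda>z. c (triv w # z) r) bs"
      let ?P = "ract (c (triv w # butlast bs)) (last bs) r"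
      let ?D = "if w = v then c bs r else 0"
      have merges_h: "merges (\<lambda>z. ?h z r) bs = ?T" using r by (simp add: w_def)
      have "lact (triv v) (?h ys) r = ?D" using r by (simp add: lact_triv w_def bs_def)
      then have dh: "hdif n ?h bs r = ?D + ?T + (-1) ^ Suc n * ?P"
        unfolding hdif_def ract_h merges_h bs by simp
      \<comment> \<open>As \<open>w\<close> is the start of \<open>r\<close>, the outer left action
        returns \<open>c bs r\<close>; the other terms are those of
        \<open>hdif n ?h\<close>.\<close>
      have "hdif (Suc n) c (triv w # bs) r = 0"
        by (rule cocycle_hdif[OF c]) (use w bs in auto)
      moreover have "merges (\<lambda>z. c z r) (triv w # bs) = - ?D - ?T"
        using sub by (simp add: bs_def nzprod_triv_left pcat_triv_left eq_commute[of v])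
      moreover have "lact (triv w) (c bs) r = c bs r" using r by (simp add: lact_triv w_def)
      moreover have "butlast (triv w # bs) = triv w # butlast bs" "last (triv w # bs) = last bs"
        using bs by auto
      ultimately have "c bs r = ?D + ?T + (-1) ^ Suc n * ?P"
        by (simp add: hdif_def[of "Suc n"] algebra_simps)
      with dh show ?thesis by (simp add: xs bs_def)
    qed (use is_cochain_hdif[of n ?h] c len sub in \<open>simp add: is_cochain_def cocycle_def\<close>)
  qed
qed

text \<open>The homotopy inserts the trivial path at the end of the \<open>j\<close>-th argument.\<close>

lemma unital_step_Suc:
  assumes c: "cocycle Q R (Suc n) c" and u: "unital j (Suc n) c" and j: "0 < j" "j \<le> n"
  obtains h where "is_cochain Q R n h" "unital (Suc j) (Suc n) (\<lambda>z r. c z r - hdif n h z r)"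
proof
  \<comment> \<open>The sign makes \<open>hdif n ?h\<close> reproduce \<open>c\<close> with
    coefficient one in the computation of \<open>2\<close> below.\<close>
  let ?h = "\<lambda>z r. (-1) ^ j * c (take j z @ triv (pnd (z ! (j - 1))) # drop j z) r"
  have ins: "set (take j z @ triv (pnd (z ! (j - 1))) # drop j z) \<subseteq> B" if "length z = n" "set z \<subseteq> B" for z
    using that j by (auto dest: in_set_takeD in_set_dropD intro!: pend_in)
  show ch: "is_cochain Q R n ?h"
    unfolding is_cochain_def
  proof (intro allI impI, elim conjE)
    fix bs :: "('v,'a) path list" and r
    assume *: "length bs = n" "set bs \<subseteq> B" "r \<notin> B"
    then show "?h bs r = 0"
      using cochain_outside[OF cocycle_cochain[OF c] _ ins[OF *(1,2)] *(3)] j by simp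
  qed
  have bal: "balanced j (Suc n) c" using balanced_of_unital[OF c u] j by simp
  have "balanced j n ?h"
    unfolding balanced_def
  proof (intro conjI allI impI)
    show "unital j n ?h"
      unfolding unital_def
    proof (intro allI impI)
      fix xs v and ys :: "('v,'a) path list" and r
      assume *: "length (xs @ triv v # ys) = n" "set (xs @ triv v # ys) \<subseteq> B" "length xs < j"
      then show "?h (xs @ triv v # ys) r = 0"
        using ins[of "xs @ triv v # ys"] j
        by (simp add: take_Cons' del: append_assoc) (auto intro!: unitalD[OF u])
    qed
  next
    fix xs a b and ys :: "('v,'a) path list" and r
    assume *: "length (xs @ a # b # ys) = n" "set (xs @ a # b # ys) \<subseteq> B" "Suc (length xs) < j" "pnd a \<noteq> pstart b"
    then show "?h (xs @ a # b # ys) r = 0"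
      using ins[of "xs @ a # b # ys"] j
      by (simp add: take_Cons' del: append_assoc) (auto intro!: balancedD(2)[OF bal])
  next
    fix b and ys :: "('v,'a) path list" and r :: "('v,'a) path"
    assume *: "length (b # ys) = n" "set (b # ys) \<subseteq> B" "0 < j" "pstart r \<noteq> pstart b"
    then show "?h (b # ys) r = 0"
      using ins[of "b # ys"] j
      by (simp add: take_Cons' del: append_assoc) (auto intro!: balancedD(3)[OF bal])
  qed (use j in simp)
  then have uh: "unital j (Suc n) (hdif n ?h)"
    using unital_hdif[of j n ?h] ch j by simp
  show "unital (Suc j) (Suc n) (\<lambda>z r. c z r - hdif n ?h z r)"
    unfolding unital_def
  proof (intro allI impI)
    fix xs v and ys :: "('v,'a) path list" and r
    assume len: "length (xs @ triv v # ys) = Suc n" and sub: "set (xs @ triv v # ys) \<subseteq> B" and xs: "length xs < Suc j"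
    show "c (xs @ triv v # ys) r - hdif n ?h (xs @ triv v # ys) r = 0"
    proof (cases "length xs < j")
      case True
      then show ?thesis using unitalD[OF u len sub] unitalD[OF uh len sub] by simp
    next
      case False
      with xs j obtain xs0 x where xs: "xs = xs0 @ [x]" and j': "j = Suc (length xs0)"
        by (cases xs rule: rev_cases) auto
      let ?e = "triv v"
      define e' where "e' = (triv (pnd x) :: ('v,'a) path)"
      have x: "x \<in> B" and e: "?e \<in> B" and e': "e' \<in> B" using sub xs pend_in[of x] by (auto simp: e'_def)
      define H where "H = ?h"
      have h: "H (xs0 @ x # z) = (\<lambda>q. (-1) ^ j * c (xs0 @ x # e' # z) q)" for z
        by (simp add: H_def j' e'_def)
      let ?T = "merges (\<lambda>z. c (xs0 @ x # e' # z) r) (?e # ys)"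
      let ?P = "ract (c (xs0 @ x # e' # butlast (?e # ys))) (last (?e # ys)) r"
      let ?C = "c (xs0 @ x # ?e # ys) r"
      let ?s = "(-1) ^ length xs0 :: 'b"
      let ?D = "if pnd x = v then ?C else 0"
      \<comment> \<open>Terms changing something to the left of \<open>e'\<close>, other than the
        product \<open>x e'\<close>, shift \<open>e'\<close> into the first \<open>j\<close>
        positions and vanish by \<open>u\<close>.\<close>
      have 1: "?s * (- ?C + ?D + ?T) + (-1) ^ Suc (Suc n) * ?P = 0"
      proof -
        have len': "length (xs0 @ x # e' # ?e # ys) = Suc (Suc n)" and sub': "set (xs0 @ x # e' # ?e # ys) \<subseteq> B"
          using len sub xs e' by auto
        have "hdif (Suc n) c (xs0 @ x # e' # ?e # ys) r = 0" by (rule cocycle_hdif[OF c len' sub'])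
        moreover have "lact p (c (tl (xs0 @ x # e' # ?e # ys))) r = 0" for p
          using len' sub' j' unfolding e'_def by (intro lact_triv_tl[OF u]) auto
        moreover have "merges (\<lambda>z. c z r) (xs0 @ x # e' # ?e # ys) = ?s * (- ?C + ?D + ?T)"
        proof -
          have "merges (\<lambda>z. c (z @ e' # ?e # ys) r) (xs0 @ [x]) = 0"
            using len' sub' j' unfolding e'_def by (intro merges_triv_left[OF u]) auto
          moreover have "nzprod e' ?e \<longleftrightarrow> pnd x = v" "nzprod x e'" "pcat e' ?e = e'" "pcat x e' = x"
            using x e e' by (auto simp: e'_def nzprod_triv_right)
          ultimately show ?thesis
            by (simp add: merges_append[of "\<lambda>z. c z r" xs0 x "e' # ?e # ys"]) (simp add: e'_def)
        qed
        moreover have "butlast (xs0 @ x # e' # ?e # ys) = xs0 @ x # e' # butlast (?e # ys)"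
          "last (xs0 @ x # e' # ?e # ys) = last (?e # ys)"
          by (simp_all add: butlast_append)
        ultimately show ?thesis by (simp only: hdif_def) simp
      qed
      have 2: "hdif n H (xs0 @ x # ?e # ys) r = ?s * (- ((-1) ^ j * ?D) - (-1) ^ j * ?T) + (-1) ^ Suc n * ((-1) ^ j * ?P)"
      proof -
        let ?bs = "xs0 @ x # ?e # ys"
        have h': "H (w @ ?e # ys) q = 0" if "Suc (length w) = j" "length (w @ ys) = length (xs0 @ ys)" "set w \<subseteq> B" for w q
        proof -
          have "c (w @ triv v # triv v # ys) q = 0"
            using that len sub xs j' by (intro unitalD[OF u]) auto
          then show ?thesis by (simp add: H_def flip: that(1))
        qed
        have "H (tl ?bs) q = 0" for q
          using h'[of "tl (xs0 @ [x])" q] sub xs j' by (cases xs0) simp_all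
        then have "lact (hd ?bs) (H (tl ?bs)) r = 0" by (intro lact_eq_0) simp
        moreover have "merges (\<lambda>z. H (z @ ?e # ys) r) (xs0 @ [x]) = 0"
        proof (rule merges_eq_0, goal_cases)
          case (1 p a b q)
          then have l: "length (p @ pcat a b # q) = length xs0"
            by (metis add_Suc_right length_append_singleton length_Cons length_append nat.inject)
          have "set (p @ a # b # q) \<subseteq> B" using sub xs 1(1) by (metis set_append le_sup_iff)
          then have "set (p @ pcat a b # q) \<subseteq> B" using 1(2) by auto
          then show ?case using l j' by (intro h') simp_all
        qed
        moreover have "nzprod x ?e \<longleftrightarrow> pnd x = v" using x by (simp add: nzprod_triv_right)
        moreover have "merges (\<lambda>z. H (xs0 @ x # z) r) (?e # ys) = (-1) ^ j * ?T"
          unfolding h merges_scale ..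
        moreover have "?D = (if pnd x = v then c (xs0 @ x # e' # ys) r else 0)" by (simp add: e'_def)
        moreover have "ract (H (butlast ?bs)) (last ?bs) r = (-1) ^ j * ?P"
        proof -
          have "butlast ?bs = xs0 @ x # butlast (?e # ys)" "last ?bs = last (?e # ys)"
            by (simp_all add: butlast_append)
          then show ?thesis by (simp only: h ract_scale)
        qed
        ultimately show ?thesis
          by (simp only: hdif_def merges_append[of "\<lambda>z. H z r" xs0 x "?e # ys"]) (simp add: h if_distrib[of "(*) _"] cong: if_cong)
      qed
      have "?s * ?s = 1" by (simp flip: power_add)
      have "hdif n H (xs0 @ x # ?e # ys) r = ?s * ?s * (?D + ?T) + ?s * ((-1) ^ n * ?P)"
        unfolding 2 j' by (simp add: algebra_simps)
      also have "\<dots> = ?s * (?s * (- ?C + ?D + ?T) + (-1) ^ Suc (Suc n) * ?P) + ?s * ?s * ?C"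
        by (simp add: algebra_simps)
      also have "\<dots> = ?C" unfolding 1 \<open>?s * ?s = 1\<close> by simp
      finally show ?thesis by (simp add: xs H_def)
    qed
  qed
qed

section \<open>Cohomologous cochains and complete normalisation at the vertices\<close>

definition cohom :: "nat \<Rightarrow> ('v,'a,'k::field) cochain \<Rightarrow> ('v,'a,'k) cochain \<Rightarrow> bool" where
  "cohom n c c' \<longleftrightarrow> (\<exists>h. is_cochain Q R n h \<and> c' = (\<lambda>z r. c z r - hdif n h z r))"

lemma cohom_refl:
  fixes c :: "('v,'a,'k::field) cochain"
  shows "cohom n c c"
proof -
  have "is_cochain Q R n (\<lambda>_ _. 0 :: 'k)" by (simp add: is_cochain_def)
  moreover have "hdif n (\<lambda>_ _. 0) = (\<lambda>_ _. 0 :: 'k)" by (intro ext) (simp add: hdif_def)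
  ultimately show ?thesis unfolding cohom_def by (intro exI[of _ "\<lambda>_ _. 0"]) simp
qed

lemma cohom_trans: "cohom n c d \<Longrightarrow> cohom n d e \<Longrightarrow> cohom n c e"
proof -
  assume "cohom n c d" "cohom n d e"
  then obtain h h' where "is_cochain Q R n h" "d = (\<lambda>z r. c z r - hdif n h z r)"
    "is_cochain Q R n h'" "e = (\<lambda>z r. d z r - hdif n h' z r)" by (auto simp: cohom_def)
  then show ?thesis unfolding cohom_def
    by (intro exI[of _ "\<lambda>z r. h z r + h' z r"]) (auto simp: hdif_add is_cochain_def diff_diff_eq)
qed

lemma cohom_cocycle: "cohom n c d \<Longrightarrow> cocycle Q R (Suc n) c \<Longrightarrow> cocycle Q R (Suc n) d"
  by (auto simp: cohom_def cocycle_diff_hdif)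

lemma exists_unital:
  assumes "cocycle Q R (Suc n) c"
  obtains d where "cohom n c d" "cocycle Q R (Suc n) d" "unital (Suc n) (Suc n) d"
proof -
  have "\<exists>d. cohom n c d \<and> unital j (Suc n) d" if "j \<le> Suc n" for j
    using that
  proof (induction j)
    case 0
    have "unital 0 (Suc n) c" by (simp add: unital_def)
    then show ?case using cohom_refl by blast
  next
    case (Suc j)
    then obtain d where d: "cohom n c d" "unital j (Suc n) d" by auto
    have d': "cocycle Q R (Suc n) d" using cohom_cocycle d assms by blast
    obtain h where "is_cochain Q R n h" "unital (Suc j) (Suc n) (\<lambda>z r. d z r - hdif n h z r)"
    proof (cases "j = 0")
      case True
      then show ?thesis using unital_step_0[OF d'] that by auto
    next
      case False
      then show ?thesis using unital_step_Suc[OF d' d(2)] that Suc.prems by auto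
    qed
    then show ?case using cohom_trans[OF d(1)] unfolding cohom_def by blast
  qed
  then show ?thesis using that cohom_cocycle assms by blast
qed

subsection \<open>Normalisation at the arrows\<close>

text \<open>For a cocycle the condition implies that interior arguments are arrows and that factors can be
  pulled out of the first and the last argument, see the lemmas \<open>radical_interior\<close>, \<open>radical_first\<close>
  and \<open>radical_last\<close> below.\<close>

definition radical :: "nat \<Rightarrow> nat \<Rightarrow> ('v,'a,'k::field) cochain \<Rightarrow> bool" where
  "radical k n c \<longleftrightarrow> (\<forall>xs a b ys r. length (xs @ a # b # ys) = n \<longrightarrow> set (xs @ a # b # ys) \<subseteq> B \<longrightarrow>
     length xs < k \<longrightarrow> nzprod a b \<longrightarrow> c (xs @ a # b # ys) r = 0)"

lemma radD: "radical k n c \<Longrightarrow> length (xs @ a # b # ys) = n \<Longrightarrow> set (xs @ a # b # ys) \<subseteq> B \<Longrightarrow>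
     length xs < k \<Longrightarrow> nzprod a b \<Longrightarrow> c (xs @ a # b # ys) r = 0"
  by (simp add: radical_def)

text \<open>A merge into \<open>a\<close> from the left keeps its last arrow, so the product with
  \<open>b\<close> stays nonzero; this is where \<open>a\<close> must be nontrivial. The bound is
  \<open>\<le>\<close> here and \<open><\<close> in the counterpart on the right, because a merge on
  the left moves the pair one place forward.\<close>

lemma merges_radical_left:
  assumes c: "radical k n c" and len: "length (xs @ a # b # ys) = Suc n" and sub: "set (xs @ a # b # ys) \<subseteq> B"
    and ab: "nzprod a b" "snd a \<noteq> []" and k: "length xs \<le> k"
  shows "merges (\<lambda>z. c (z @ b # ys) r) (xs @ [a]) = 0"
proof (rule merges_eq_0, goal_cases)
  case (1 p u w q)
  show ?case
  proof (cases q rule: rev_cases)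
    case Nil
    then have *: "w = a" "xs = p @ [u]" using 1 by auto
    then have "nzprod (pcat u w) b" using 1 ab sub by (simp add: nzprod_pcat_left)
    then show ?thesis using * 1 len sub k Nil by (auto intro!: radD[OF c])
  next
    case (snoc q' a')
    then have *: "a' = a" "xs = p @ u # w # q'" using 1 by auto
    show ?thesis using * 1 len sub k snoc ab radD[OF c, of "p @ pcat u w # q'" a b ys r] by auto
  qed
qed

lemma merges_radical_right:
  assumes c: "radical k n c" and len: "length (xs @ a # b # ys) = Suc n" and sub: "set (xs @ a # b # ys) \<subseteq> B"
    and ab: "nzprod a b" "snd b \<noteq> []" and k: "length xs < k"
  shows "merges (\<lambda>z. c (xs @ a # z) r) (b # ys) = 0"
proof (rule merges_eq_0, goal_cases)
  case (1 p u w q)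
  show ?case
  proof (cases p)
    case Nil
    then have "u = b" "ys = w # q" using 1 by auto
    moreover from this have "nzprod a (pcat u w)" using 1 ab sub by (simp add: nzprod_pcat_right)
    ultimately show ?thesis using 1 len sub k Nil by (auto intro!: radD[OF c])
  next
    case (Cons b' p')
    then have "b' = b" "ys = p' @ u # w # q" using 1 by auto
    then show ?thesis using 1 len sub k ab Cons by (auto intro!: radD[OF c])
  qed
qed

lemma lact_radical_tl:
  assumes "radical k n c" "length (xs @ a # b # ys) = Suc n" "set (xs @ a # b # ys) \<subseteq> B"
    and "nzprod a b" "length xs \<le> k" "xs \<noteq> []"
  shows "lact p (c (tl (xs @ a # b # ys))) r = 0"
proof (rule lact_eq_0)
  show "c (tl (xs @ a # b # ys)) q = 0" for q
    using assms radD[OF assms(1), of "tl xs" a b ys q] by (cases xs) auto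
qed

lemma ract_radical_butlast:
  assumes "radical k n c" "length (xs @ a # b # ys) = Suc n" "set (xs @ a # b # ys) \<subseteq> B"
    and "nzprod a b" "length xs < k" "ys \<noteq> []"
  shows "ract (c (butlast (xs @ a # b # ys))) p r = 0"
proof (rule ract_eq_0)
  show "c (butlast (xs @ a # b # ys)) q = 0" for q
    using assms radD[OF assms(1), of xs a b "butlast ys" q] by (auto simp: butlast_append dest: in_set_butlastD)
qed

text \<open>In every other term of the cocycle identity on \<open>xs @ a # b # ys\<close> a
  neighbouring pair with nonzero product survives within the range of \<open>radical\<close>. For
  the first and last argument one outer action remains in addition, which gives the next two
  lemmas.\<close>

lemma radical_interior:
  assumes c: "cocycle Q R n c" "radical k n c"
    and len: "length (xs @ a # b # ys) = Suc n" and sub: "set (xs @ a # b # ys) \<subseteq> B"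
    and ab: "nzprod a b" "snd a \<noteq> []" "snd b \<noteq> []" and xs: "xs \<noteq> []" "length xs < k" "ys \<noteq> []"
  shows "c (xs @ pcat a b # ys) r = 0"
proof -
  have "hdif n c (xs @ a # b # ys) r = 0" by (rule cocycle_hdif[OF c(1) len sub])
  moreover note lact_radical_tl[OF c(2) len sub ab(1) less_imp_le[OF xs(2)] xs(1)]
    ract_radical_butlast[OF c(2) len sub ab(1) xs(2,3)]
  moreover have "merges (\<lambda>z. c z r) (xs @ a # b # ys) = (-1) ^ length xs * - c (xs @ pcat a b # ys) r"
    using merges_radical_left[OF c(2) len sub ab(1,2) less_imp_le[OF xs(2)]] merges_radical_right[OF c(2) len sub ab(1,3) xs(2)]
      ab by (subst merges_append) simp
  ultimately show ?thesis by (simp add: hdif_def)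
qed

lemma radical_first:
  assumes c: "cocycle Q R n c" "radical k n c"
    and len: "length (a # b # ys) = Suc n" and sub: "set (a # b # ys) \<subseteq> B"
    and ab: "nzprod a b" "snd b \<noteq> []" and k: "0 < k" "ys \<noteq> []"
  shows "c (pcat a b # ys) r = lact a (c (b # ys)) r"
proof -
  have "hdif n c (a # b # ys) r = 0" by (rule cocycle_hdif[OF c(1) len sub])
  moreover have "merges (\<lambda>z. c (a # z) r) (b # ys) = 0"
    using merges_radical_right[OF c(2), of "[]" a b ys r] len sub ab k by simp
  moreover have "ract (c (butlast (a # b # ys))) p r = 0" for p
    using ract_radical_butlast[OF c(2), of "[]" a b ys p r] len sub ab k by simp
  ultimately show ?thesis using ab by (simp add: hdif_def)
qed

lemma radical_last:
  assumes c: "cocycle Q R n c" "radical k n c"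
    and len: "length (xs @ [a, b]) = Suc n" and sub: "set (xs @ [a, b]) \<subseteq> B"
    and ab: "nzprod a b" "snd a \<noteq> []" and k: "n \<le> Suc k" "xs \<noteq> []"
  shows "c (xs @ [pcat a b]) r = ract (c (xs @ [a])) b r"
proof -
  have "length xs \<le> k" using len k by simp
  have "hdif n c (xs @ [a, b]) r = 0" by (rule cocycle_hdif[OF c(1) len sub])
  moreover note lact_radical_tl[OF c(2) len sub ab(1) \<open>length xs \<le> k\<close> k(2)]
  moreover have "merges (\<lambda>z. c z r) (xs @ [a, b]) = (-1) ^ length xs * - c (xs @ [pcat a b]) r"
    using merges_radical_left[OF c(2) len sub ab \<open>length xs \<le> k\<close>] ab by (subst merges_append) simp
  moreover have "n = Suc (length xs)" using len by simp
  ultimately show ?thesis by (simp add: hdif_def butlast_append flip: distrib_left)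
qed

section \<open>Koszul tuples\<close>

definition arrow_list :: "('v,'a) path list \<Rightarrow> bool" where
  "arrow_list ds \<longleftrightarrow> set ds \<subseteq> B \<and> (\<forall>p\<in>set ds. length (snd p) = 1)"

text \<open>In positive length these tuples index the generators of the minimal bimodule resolution
  of a quadratic monomial algebra.\<close>

definition koszul :: "('v,'a) path list \<Rightarrow> bool" where
  "koszul ds \<longleftrightarrow> arrow_list ds \<and> successively (\<lambda>p q. pnd p = pstart q \<and> \<not> nzprod p q) ds"

lemma merges_koszul: "koszul ds \<Longrightarrow> merges F ds = 0"
  by (rule merges_eq_0) (auto simp: koszul_def successively_append_iff)

text \<open>The merges vanish and the outer terms read lists of arrows only. Corrections of this
  kind keep all Koszul values, hence also \<open>clean\<close>.\<close>

lemma hdif_koszul: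
  assumes "koszul ds" "length ds = Suc n" "\<And>ds r. arrow_list ds \<Longrightarrow> length ds = n \<Longrightarrow> h ds r = 0"
  shows "hdif n h ds r = 0"
proof -
  have "arrow_list (tl ds)" "arrow_list (butlast ds)"
    using assms(1) by (auto simp: koszul_def arrow_list_def dest: in_set_butlastD) (cases ds; auto)+
  then have "lact (hd ds) (h (tl ds)) r = 0" "ract (h (butlast ds)) (last ds) r = 0"
    using assms by (auto intro!: lact_eq_0 ract_eq_0)
  then show ?thesis using merges_koszul[OF assms(1)] by (simp add: hdif_def)
qed

lemma head_arrow_pcat: "snd p \<noteq> [] \<Longrightarrow> head_arrow (pcat p q) = head_arrow p" "nzprod p q \<Longrightarrow> snd p \<noteq> [] \<Longrightarrow> tail_path (pcat p q) = pcat (tail_path p) q"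
  by (simp_all add: head_arrow_def tail_path_def pcat_def)

lemma head_arrow_ends: "p \<in> B \<Longrightarrow> snd p \<noteq> [] \<Longrightarrow> pstart (head_arrow p) = pstart p" "p \<in> B \<Longrightarrow> snd p \<noteq> [] \<Longrightarrow> pnd (tail_path p) = pnd p"
  using head_arrow_tail_path[of p] pend_pcat[of "head_arrow p" "tail_path p"] by (simp_all add: head_arrow_def pstart_def)

lemma nzprod_head_arrow: "a \<in> B \<Longrightarrow> b \<in> B \<Longrightarrow> snd b \<noteq> [] \<Longrightarrow> nzprod a b \<Longrightarrow> nzprod a (head_arrow b)"
  using head_arrow_tail_path[of b] nzprod_pcat_right[of a "head_arrow b" "tail_path b"] by simp

lemma nzprod_tail_path: "a \<in> B \<Longrightarrow> b \<in> B \<Longrightarrow> snd a \<noteq> [] \<Longrightarrow> nzprod a b \<Longrightarrow> nzprod (tail_path a) b"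
  using head_arrow_tail_path[of a] nzprod_assoc[of "head_arrow a" "tail_path a" b] by simp

lemma list_split_at: "i < length z \<Longrightarrow> \<exists>us p vs. z = us @ p # vs \<and> length us = i"
  by (metis id_take_nth_drop length_take min_absorb2 less_imp_le)

lemma unital_full: "unital n n c \<Longrightarrow> p \<in> set ds \<Longrightarrow> snd p = [] \<Longrightarrow> length ds = n \<Longrightarrow> set ds \<subseteq> B \<Longrightarrow> c ds r = 0"
proof -
  assume *: "unital n n c" "p \<in> set ds" "snd p = []" "length ds = n" "set ds \<subseteq> B"
  then obtain xs ys where "ds = xs @ p # ys" by (metis split_list)
  moreover obtain v where "p = triv v" using *(3) by (cases p) auto
  ultimately show ?thesis using * by (auto intro!: unitalD[OF *(1)])
qed

lemma radical_hdif:
  assumes h: "radical k n h" and kn: "k < n"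
    and uh: "unital (Suc n) (Suc n) (hdif n h)"
    and int: "\<And>xs a b ys r. length (xs @ a # b # ys) = Suc n \<Longrightarrow> set (xs @ a # b # ys) \<subseteq> B \<Longrightarrow> nzprod a b \<Longrightarrow>
      snd a \<noteq> [] \<Longrightarrow> snd b \<noteq> [] \<Longrightarrow> xs \<noteq> [] \<Longrightarrow> length xs < k \<Longrightarrow> h (xs @ pcat a b # ys) r = 0"
    and first: "\<And>a b ys r. length (a # b # ys) = Suc n \<Longrightarrow> set (a # b # ys) \<subseteq> B \<Longrightarrow> nzprod a b \<Longrightarrow>
      snd b \<noteq> [] \<Longrightarrow> 0 < k \<Longrightarrow> h (pcat a b # ys) r = lact a (h (b # ys)) r"
  shows "radical k (Suc n) (hdif n h)"
  unfolding radical_def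
proof (intro allI impI)
  fix xs a b ys r
  assume len: "length (xs @ a # b # ys) = Suc n" and sub: "set (xs @ a # b # ys) \<subseteq> B"
    and k: "length xs < k" and ab: "nzprod a b"
  have ys: "ys \<noteq> []" using len k kn by auto
  show "hdif n h (xs @ a # b # ys) r = 0"
  proof (cases "snd a = [] \<or> snd b = []")
    case True
    then show ?thesis using unital_full[OF uh, of a "xs @ a # b # ys" r]
        unital_full[OF uh, of b "xs @ a # b # ys" r] len sub by auto
  next
    case False
    note right = merges_radical_right[OF h len sub ab _ k] and ract = ract_radical_butlast[OF h len sub ab k ys]
    show ?thesis
    proof (cases "xs = []")
      case True
      then show ?thesis using first[of a b ys r] right ract len sub ab False k by (simp add: hdif_def)
    next
      case xs: False
      then show ?thesis
        using int[of xs a b ys r] right ract len sub ab False k merges_radical_left[OF h len sub ab]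
          lact_radical_tl[OF h len sub ab _ xs]
        by (simp add: hdif_def merges_append[of "\<lambda>z. h z r" xs a "b # ys"])
    qed
  qed
qed

text \<open>The homotopy splits the first arrow off the argument in position \<open>j\<close> (counted from 0).\<close>

lemma radical_step_Suc:
  assumes c: "cocycle Q R (Suc n) c" and u: "unital (Suc n) (Suc n) c" and radical: "radical j (Suc n) c"
    and j: "0 < j" "j < n"
  obtains h where "is_cochain Q R n h" "unital (Suc n) (Suc n) (\<lambda>z r. c z r - hdif n h z r)"
    "radical (Suc j) (Suc n) (\<lambda>z r. c z r - hdif n h z r)"
    "\<And>ds r. arrow_list ds \<Longrightarrow> length ds = n \<Longrightarrow> h ds r = 0"
proof -
  \<comment> \<open>The sign makes \<open>hdif n h\<close> return \<open>c\<close> with coefficient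
    one in \<open>dh\<close>; the value 0 on trivial paths avoids the head of an empty list.\<close>
  define h where "h z r = (if snd (z ! j) = [] then 0 else
      (-1) ^ Suc j * c (take j z @ head_arrow (z ! j) # tail_path (z ! j) # drop (Suc j) z) r)" for z r
  have h: "h (xs @ a # ys) = (\<lambda>r. if snd a = [] then 0 else (-1) ^ Suc j * c (xs @ head_arrow a # tail_path a # ys) r)"
    if "length xs = j" for xs a ys using that by (auto simp: h_def)
  have split: "\<exists>xs a ys. z = xs @ a # ys \<and> length xs = j" if "length z = n" for z :: "('v,'a) path list"
    using list_split_at[of j z] j that by blast
  have bal: "balanced (Suc (Suc n)) (Suc n) c" using balanced_of_unital[OF c u] by simp
  have ch: "is_cochain Q R n h"
    unfolding is_cochain_def
  proof (intro allI impI, elim conjE)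
    fix z :: "('v,'a) path list" and r assume z: "length z = n" "set z \<subseteq> B" "r \<notin> B"
    then obtain xs a ys where "z = xs @ a # ys" "length xs = j" using split by blast
    then show "h z r = 0" using z head_arrow_tail_path[of a] by (auto simp: h intro!: cochain_outside[OF cocycle_cochain[OF c]])
  qed
  have hu: "unital n n h"
    unfolding unital_def
  proof (intro allI impI)
    fix xs v ys r assume *: "length (xs @ triv v # ys) = n" "set (xs @ triv v # ys) \<subseteq> B"
    then obtain xs' a ys' where z: "xs @ triv v # ys = xs' @ a # ys'" "length xs' = j" using split by blast
    have "triv v \<in> set (xs' @ a # ys')" unfolding z(1)[symmetric] by simp
    then have "triv v = a \<or> triv v \<in> set (xs' @ head_arrow a # tail_path a # ys')" by auto
    moreover have "snd a \<noteq> [] \<Longrightarrow> set (xs' @ head_arrow a # tail_path a # ys') \<subseteq> B"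
      using *(2) head_arrow_tail_path[of a] unfolding z by auto
    moreover have "length (xs' @ head_arrow a # tail_path a # ys') = Suc n" using *(1) unfolding z by simp
    ultimately show "h (xs @ triv v # ys) r = 0"
      unfolding z(1) h[OF z(2)] using unital_full[OF u, of "triv v" "xs' @ head_arrow a # tail_path a # ys'" r] by auto
  qed
  have "balanced (Suc n) n h"
    unfolding balanced_def
  proof (intro conjI allI impI)
    show "unital (Suc n) n h" using hu by (auto simp: unital_def)
  next
    fix xs a b ys r
    assume *: "length (xs @ a # b # ys) = n" "set (xs @ a # b # ys) \<subseteq> B" "pnd a \<noteq> pstart b"
    consider "length xs = j" | "j = Suc (length xs)" | "Suc (length xs) < j" | "j < length xs" by linarith
    then show "h (xs @ a # b # ys) r = 0"
    proof cases
      case 1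
      then show ?thesis using * head_arrow_tail_path[of a] head_arrow_ends[of a]
        balancedD(2)[OF bal, of "xs @ [head_arrow a]" "tail_path a" b ys r] by (auto simp: h)
    next
      case 2
      then show ?thesis using * head_arrow_tail_path[of b] head_arrow_ends[of b]
        balancedD(2)[OF bal, of xs a "head_arrow b" "tail_path b # ys" r] h[of "xs @ [a]" b ys] by auto
    next
      case 3
      then have "j - Suc (Suc (length xs)) < length ys" using *(1) j by auto
      then obtain us p vs where "ys = us @ p # vs" "Suc (Suc (length xs + length us)) = j"
        using list_split_at[of "j - Suc (Suc (length xs))" ys] 3 by auto
      then show ?thesis using * head_arrow_tail_path[of p] h[of "xs @ a # b # us" p vs]
        balancedD(2)[OF bal, of xs a b "us @ head_arrow p # tail_path p # vs" r] by auto
    next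
      case 4
      then obtain us p vs where "xs = us @ p # vs" "length us = j" using list_split_at by blast
      then show ?thesis using * head_arrow_tail_path[of p] h[of us p "vs @ a # b # ys"]
        balancedD(2)[OF bal, of "us @ head_arrow p # tail_path p # vs" a b ys r] by auto
    qed
  next
    fix b ys and r :: "('v,'a) path"
    assume *: "length (b # ys) = n" "set (b # ys) \<subseteq> B" "pstart r \<noteq> pstart b"
    obtain us p vs where "b # ys = us @ p # vs" "length us = j" using split[OF *(1)] by blast
    moreover from this j obtain us' where "us = b # us'" "ys = us' @ p # vs" by (cases us) auto
    ultimately show "h (b # ys) r = 0" using * head_arrow_tail_path[of p] h[of us p vs]
       balancedD(3)[OF bal, of b "us' @ head_arrow p # tail_path p # vs" r] by auto
  next
    fix xs b r
    assume *: "length (xs @ [b]) = n" "set (xs @ [b]) \<subseteq> B" "pnd r \<noteq> pnd b"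
    show "h (xs @ [b]) r = 0"
    proof (cases "length xs = j")
      case True
      then show ?thesis using * head_arrow_tail_path[of b] head_arrow_ends[of b]
        balancedD(4)[OF bal, of "xs @ [head_arrow b]" "tail_path b" r] by (auto simp: h)
    next
      case False
      then have "j < length xs" using * j by auto
      then obtain us p vs where "xs = us @ p # vs" "length us = j" using list_split_at by blast
      then show ?thesis using * head_arrow_tail_path[of p] h[of us p "vs @ [b]"]
        balancedD(4)[OF bal, of "us @ head_arrow p # tail_path p # vs" b r] by auto
    qed
  qed
  then have uh: "unital (Suc n) (Suc n) (hdif n h)"
    using unital_hdif[of "Suc n" n h] ch j by simp
  have hrad: "radical j n h"
    unfolding radical_def
  proof (intro allI impI)
    fix xs a b ys r
    assume *: "length (xs @ a # b # ys) = n" "set (xs @ a # b # ys) \<subseteq> B" "length xs < j" "nzprod a b"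
    show "h (xs @ a # b # ys) r = 0"
    proof (cases "j = Suc (length xs)")
      case True
      then show ?thesis using * head_arrow_tail_path[of b] nzprod_head_arrow[of a b]
        radD[OF radical, of xs a "head_arrow b" "tail_path b # ys" r] h[of "xs @ [a]" b ys] by auto
    next
      case False
      then have "j - Suc (Suc (length xs)) < length ys" using *(1,3) j by auto
      then obtain us p vs where "ys = us @ p # vs" "Suc (Suc (length xs + length us)) = j"
        using list_split_at[of "j - Suc (Suc (length xs))" ys] False *(3) by auto
      then show ?thesis using * head_arrow_tail_path[of p] h[of "xs @ a # b # us" p vs]
        radD[OF radical, of xs a b "us @ head_arrow p # tail_path p # vs" r] by auto
    qed
  qed
  \<comment> \<open>The differential of \<open>h\<close> is compared with the cocycle identity on
    the list in which \<open>a\<close> is split into \<open>a1\<close> and \<open>a2\<close>. From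
    the split on the terms correspond; those further left vanish by \<open>radical\<close>.\<close>
  have dh: "hdif n h (xs @ a # b # ys) r = c (xs @ a # b # ys) r"
    if len: "length (xs @ a # b # ys) = Suc n" and sub: "set (xs @ a # b # ys) \<subseteq> B" and xs: "length xs = j"
      and ab: "nzprod a b" "snd a \<noteq> []" "snd b \<noteq> []" for xs a b ys r
  proof -
    define a1 a2 where "a1 = head_arrow a" and "a2 = tail_path a"
    have a: "a \<in> B" "b \<in> B" using sub by auto
    have a12: "a1 \<in> B" "a2 \<in> B" "nzprod a1 a2" "pcat a1 a2 = a" "snd a1 \<noteq> []" "nzprod a2 b"
      using head_arrow_tail_path[OF a(1) ab(2)] nzprod_tail_path[OF a ab(2,1)] by (auto simp: a1_def a2_def)
    have b12: "head_arrow b \<in> B" "tail_path b \<in> B" "nzprod a (head_arrow b)"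
      using head_arrow_tail_path[OF a(2) ab(3)] nzprod_head_arrow[OF a ab(3,1)] by auto
    have xs0: "xs \<noteq> []" using xs j by auto
    have ha: "h (xs @ a # z) = (\<lambda>r. (-1) ^ Suc j * c (xs @ a1 # a2 # z) r)" for z
      using ab(2) by (simp add: h[OF xs] a1_def a2_def)
    let ?T = "merges (\<lambda>z. c (xs @ a1 # a2 # z) r) (b # ys)"
    let ?P = "ract (c (xs @ a1 # a2 # butlast (b # ys))) (last (b # ys)) r"
    let ?C = "c (xs @ a # b # ys) r" and ?D = "c (xs @ a1 # pcat a2 b # ys) r"
    let ?s = "(-1) ^ length xs :: 'b"
    have 1: "?s * (- ?C + ?D + ?T) + (-1) ^ Suc (Suc n) * ?P = 0"
    proof -
      have len': "length (xs @ a1 # a2 # b # ys) = Suc (Suc n)" and sub': "set (xs @ a1 # a2 # b # ys) \<subseteq> B"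
        using len sub a12 by auto
      have "hdif (Suc n) c (xs @ a1 # a2 # b # ys) r = 0" by (rule cocycle_hdif[OF c len' sub'])
      moreover have "lact p (c (tl (xs @ a1 # a2 # b # ys))) r = 0" for p
        by (rule lact_radical_tl[OF radical len' sub' a12(3) _ xs0]) (simp add: xs)
      moreover have "merges (\<lambda>z. c z r) (xs @ a1 # a2 # b # ys) = ?s * (- ?C + ?D + ?T)"
        using merges_radical_left[OF radical len' sub' a12(3,5)] xs a12
        by (simp add: merges_append[of "\<lambda>z. c z r" xs a1 "a2 # b # ys"])
      moreover have "butlast (xs @ a1 # a2 # b # ys) = xs @ a1 # a2 # butlast (b # ys)"
        "last (xs @ a1 # a2 # b # ys) = last (b # ys)"
        by (simp_all add: butlast_append)
      ultimately show ?thesis by (simp only: hdif_def) simp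
    qed
    have 2: "hdif n h (xs @ a # b # ys) r = ?s * (- ((-1) ^ Suc j * ?D) - (-1) ^ Suc j * ?T) + (-1) ^ Suc n * ((-1) ^ Suc j * ?P)"
    proof -
      have "h (tl (xs @ a # b # ys)) q = 0" for q
        using h[of "tl (xs @ [a])" b ys] radD[OF radical, of "tl xs" a "head_arrow b" "tail_path b # ys" q] xs xs0 len sub b12
        by (cases xs) auto
      then have "lact p (h (tl (xs @ a # b # ys))) r = 0" for p by (intro lact_eq_0) simp
      moreover have "merges (\<lambda>z. h (z @ b # ys) r) (xs @ [a]) = 0"
      proof -
        have "merges (\<lambda>z. h (z @ b # ys) r) (xs @ [a]) = merges (\<lambda>z. (-1) ^ Suc j * c (z @ head_arrow b # tail_path b # ys) r) (xs @ [a])"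
        proof (rule merges_cong, goal_cases)
          case (1 p u w q)
          have "length (xs @ [a]) = Suc (Suc (length p + length q))" unfolding 1(1) by simp
          then have "length (p @ pcat u w # q) = j" using xs by simp
          from h[OF this, of b ys] show ?case using ab(3) by simp
        qed
        then show ?thesis using merges_radical_left[OF radical, of xs a "head_arrow b" "tail_path b # ys" r] len sub b12 ab xs
          by (simp add: merges_minus merges_scale)
      qed
      moreover have "merges (\<lambda>z. h (xs @ a # z) r) (b # ys) = (-1) ^ Suc j * ?T"
        unfolding ha merges_scale ..
      moreover have "h (xs @ pcat a b # ys) r = (-1) ^ Suc j * ?D"
        using ab by (simp add: h[OF xs] head_arrow_pcat a1_def a2_def)
      moreover have "ract (h (butlast (xs @ a # b # ys))) (last (xs @ a # b # ys)) r = (-1) ^ Suc j * ?P"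
      proof -
        have "butlast (xs @ a # b # ys) = xs @ a # butlast (b # ys)" "last (xs @ a # b # ys) = last (b # ys)"
          by (simp_all add: butlast_append)
        then show ?thesis by (simp only: ha ract_scale)
      qed
      ultimately show ?thesis using ab
        by (simp only: hdif_def merges_append[of "\<lambda>z. h z r" xs a "b # ys"]) simp
    qed
    have "?s * ?s = 1" by (simp flip: power_add)
    have "hdif n h (xs @ a # b # ys) r = ?s * ?s * (?D + ?T) + ?s * ((-1) ^ n * ?P)"
      unfolding 2 xs[symmetric] by (simp add: algebra_simps)
    also have "\<dots> = ?s * (?s * (- ?C + ?D + ?T) + (-1) ^ Suc (Suc n) * ?P) + ?s * ?s * ?C"
      by (simp add: algebra_simps)
    also have "\<dots> = ?C" unfolding 1 \<open>?s * ?s = 1\<close> by simp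
    finally show ?thesis .
  qed
  \<comment> \<open>The merge happens to the left of the position that \<open>h\<close> splits, so
    the property passes from \<open>c\<close> to \<open>h\<close>.\<close>
  have hint: "h (xs @ pcat a b # ys) r = 0"
    if *: "length (xs @ a # b # ys) = Suc n" "set (xs @ a # b # ys) \<subseteq> B" "nzprod a b" "snd a \<noteq> []" "snd b \<noteq> []"
      "xs \<noteq> []" "length xs < j" for xs a b ys r
  proof -
    have "j - Suc (length xs) < length ys" using * j by auto
    then obtain us p vs where ys: "ys = us @ p # vs" "Suc (length xs + length us) = j"
      using list_split_at[of "j - Suc (length xs)" ys] * by auto
    have "c (xs @ pcat a b # us @ head_arrow p # tail_path p # vs) r = 0" if "snd p \<noteq> []"
      using radical_interior[OF c radical, of xs a b "us @ head_arrow p # tail_path p # vs" r] * ys that head_arrow_tail_path[of p] by auto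
    then show ?thesis using ys h[of "xs @ pcat a b # us" p vs] by auto
  qed
  have hfirst: "h (pcat a b # ys) r = lact a (h (b # ys)) r"
    if *: "length (a # b # ys) = Suc n" "set (a # b # ys) \<subseteq> B" "nzprod a b" "snd b \<noteq> []" for a b ys r
  proof -
    have "j - 1 < length ys" using * j by auto
    then obtain us p vs where ys: "ys = us @ p # vs" "Suc (length us) = j"
      using list_split_at[of "j - 1" ys] j by auto
    have "c (pcat a b # us @ head_arrow p # tail_path p # vs) r = lact a (c (b # us @ head_arrow p # tail_path p # vs)) r" if "snd p \<noteq> []"
      using radical_first[OF c radical, of a b "us @ head_arrow p # tail_path p # vs" r] * ys that head_arrow_tail_path[of p] j by auto
    then show ?thesis using ys h[of "pcat a b # us" p vs] h[of "b # us" p vs]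
      by (auto simp: lact_scale lact_minus)
  qed
  have radh: "radical j (Suc n) (hdif n h)"
    using radical_hdif[OF hrad j(2) uh] hint hfirst by blast
  show ?thesis
  proof (rule that[OF ch])
    show u': "unital (Suc n) (Suc n) (\<lambda>z r. c z r - hdif n h z r)"
      using u uh by (simp add: unital_def)
    show "radical (Suc j) (Suc n) (\<lambda>z r. c z r - hdif n h z r)"
      unfolding radical_def
    proof (intro allI impI)
      fix xs a b ys r
      assume *: "length (xs @ a # b # ys) = Suc n" "set (xs @ a # b # ys) \<subseteq> B" "length xs < Suc j" "nzprod a b"
      consider "snd a = [] \<or> snd b = []" | "length xs < j" | "length xs = j" "snd a \<noteq> []" "snd b \<noteq> []"
        using * by linarith
      then show "c (xs @ a # b # ys) r - hdif n h (xs @ a # b # ys) r = 0"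
      proof cases
        case 1
        then show ?thesis using unital_full[OF u', of a "xs @ a # b # ys" r]
          unital_full[OF u', of b "xs @ a # b # ys" r] * by auto
      next
        case 2
        then show ?thesis using radD[OF radical *(1,2) _ *(4)] radD[OF radh *(1,2) _ *(4)] by simp
      next
        case 3
        then show ?thesis using dh * by simp
      qed
    qed
    \<comment> \<open>The tail of a single arrow is trivial, so unitality of \<open>c\<close>
      applies.\<close>
    show "h ds r = 0" if ds: "arrow_list ds" "length ds = n" for ds r
    proof -
      obtain xs a ys where z: "ds = xs @ a # ys" "length xs = j" using split ds by blast
      then have a: "a \<in> B" "length (snd a) = 1" using ds by (auto simp: arrow_list_def)
      then have "snd (tail_path a) = []" "head_arrow a \<in> B" "tail_path a \<in> B"
        using head_arrow_tail_path[of a] by (auto simp: tail_path_def length_Suc_conv)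
      then show ?thesis using z ds unital_full[OF u, of "tail_path a" "xs @ head_arrow a # tail_path a # ys" r]
        by (auto simp: h arrow_list_def)
    qed
  qed
qed

text \<open>In the first position the split-off arrow also acts from the left, so the homotopy has to be defined
  by recursion along the path.\<close>

primrec peel :: "('v,'a,'k::field) cochain \<Rightarrow> 'a list \<Rightarrow> 'v \<Rightarrow> ('v,'a,'k) cochain" where
  "peel c [] v ys = (\<lambda>r. 0)"
| "peel c (\<alpha> # as) v ys = (\<lambda>r. lact (v, [\<alpha>]) (peel c as (tgt Q \<alpha>) ys) r - c ((v, [\<alpha>]) # (tgt Q \<alpha>, as) # ys) r)"

lemma Cons_in_B: "(v, \<alpha> # as) \<in> B \<Longrightarrow> (v, [\<alpha>]) \<in> B" "(v, \<alpha> # as) \<in> B \<Longrightarrow> (tgt Q \<alpha>, as) \<in> B"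
  using head_arrow_tail_path[of "(v, \<alpha> # as)"] by (simp_all add: head_arrow_def tail_path_def)

lemma peel_eq_0:
  assumes "(v, as) \<in> B" "\<And>p q r. p \<in> B \<Longrightarrow> q \<in> B \<Longrightarrow> pnd q = pnd (v, as) \<Longrightarrow> c (p # q # ys) r = 0"
  shows "peel c as v ys r = 0"
  using assms
proof (induction as arbitrary: v r)
  case (Cons \<alpha> as)
  have "pnd (tgt Q \<alpha>, as) = pnd (v, \<alpha> # as)" by (simp add: pend_def)
  then show ?case using Cons.IH[of "tgt Q \<alpha>"] Cons.prems Cons_in_B[OF Cons.prems(1)]
    by (auto intro!: lact_eq_0)
qed simp

lemma radical_step_0:
  assumes c: "cocycle Q R (Suc n) c" and u: "unital (Suc n) (Suc n) c" and n: "0 < n"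
  obtains h where "is_cochain Q R n h" "unital (Suc n) (Suc n) (\<lambda>z r. c z r - hdif n h z r)"
    "radical 1 (Suc n) (\<lambda>z r. c z r - hdif n h z r)"
    "\<And>ds r. arrow_list ds \<Longrightarrow> length ds = n \<Longrightarrow> h ds r = 0"
proof -
  define h where "h z = peel c (snd (hd z)) (fst (hd z)) (tl z)" for z
  have h: "h ((v, as) # ys) = peel c as v ys" for v as ys by (simp add: h_def)
  have bal: "balanced (Suc (Suc n)) (Suc n) c" using balanced_of_unital[OF c u] by simp
  have cons: "\<exists>v as ys. z = (v, as) # ys" if "length z = n" for z :: "('v,'a) path list"
    using that n by (cases z) auto
  have ch: "is_cochain Q R n h"
    unfolding is_cochain_def
  proof (intro allI impI, elim conjE)
    fix z :: "('v,'a) path list" and r assume z: "length z = n" "set z \<subseteq> B" "r \<notin> B"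
    obtain v as ys where zz: "z = (v, as) # ys" using cons z by blast
    have "peel c as v ys r = 0"
    proof (cases as)
      case (Cons \<alpha> as')
      then have "c ((v, [\<alpha>]) # (tgt Q \<alpha>, as') # ys) r = 0" using z zz Cons_in_B[of v \<alpha> as']
        by (intro cochain_outside[OF cocycle_cochain[OF c]]) auto
      then show ?thesis using Cons z(3) by (simp add: lact_outside)
    qed simp
    then show "h z r = 0" by (simp add: zz h)
  qed
  have "balanced (Suc n) n h"
    unfolding balanced_def
  proof (intro conjI allI impI)
    show "unital (Suc n) n h"
      unfolding unital_def
    proof (intro allI impI)
      fix xs v ys r assume *: "length (xs @ triv v # ys) = n" "set (xs @ triv v # ys) \<subseteq> B"
      show "h (xs @ triv v # ys) r = 0"
      proof (cases xs)
        case Nil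
        then show ?thesis by (simp add: h)
      next
        case (Cons x xs')
        then show ?thesis using * by (cases x)
          (auto simp: h intro!: peel_eq_0 unitalD[OF u, of "_ # _ # xs'", simplified])
      qed
    qed
  next
    fix xs a b ys r
    assume *: "length (xs @ a # b # ys) = n" "set (xs @ a # b # ys) \<subseteq> B" "pnd a \<noteq> pstart b"
    show "h (xs @ a # b # ys) r = 0"
    proof (cases xs)
      case Nil
      then show ?thesis using * by (cases a)
        (auto simp: h intro!: peel_eq_0 balancedD(2)[OF bal, of "[_]", simplified])
    next
      case (Cons x xs')
      then show ?thesis using * by (cases x)
        (auto simp: h intro!: peel_eq_0 balancedD(2)[OF bal, of "_ # _ # xs'", simplified])
    qed
  next
    fix b ys and r :: "('v,'a) path"
    assume *: "length (b # ys) = n" "set (b # ys) \<subseteq> B" "pstart r \<noteq> pstart b"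
    obtain v as where b: "b = (v, as)" by fastforce
    have "peel c as v ys r = 0"
    proof (cases as)
      case (Cons \<alpha> as')
      then have "c ((v, [\<alpha>]) # (tgt Q \<alpha>, as') # ys) r = 0" using * b Cons_in_B[of v \<alpha> as']
        by (intro balancedD(3)[OF bal]) (auto simp: pstart_def)
      moreover have "lact (v, [\<alpha>]) x r = 0" for x :: "('v,'a) path \<Rightarrow> 'b" 
        using * b by (intro lact_eq_0) (auto simp: pstart_def pcat_def)
      ultimately show ?thesis using Cons by simp
    qed simp
    then show "h (b # ys) r = 0" by (simp add: b h)
  next
    fix xs b r
    assume *: "length (xs @ [b]) = n" "set (xs @ [b]) \<subseteq> B" "pnd r \<noteq> pnd b"
    show "h (xs @ [b]) r = 0"
    proof (cases xs)
      case (Cons x xs')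
      have "peel c as v (xs' @ [b]) r = 0" if "(v, as) \<in> B" for v as
        using that *(3)
      proof (induction as arbitrary: v r)
        case (Cons \<alpha> as)
        have "c ((v, [\<alpha>]) # (tgt Q \<alpha>, as) # xs' @ [b]) r = 0"
          using balancedD(4)[OF bal, of "(v, [\<alpha>]) # (tgt Q \<alpha>, as) # xs'" b r] * Cons.prems
            Cons_in_B[OF Cons.prems(1)] \<open>xs = x # xs'\<close> by simp
        then show ?case using Cons.IH[of "tgt Q \<alpha>"] Cons.prems Cons_in_B[OF Cons.prems(1)]
          by (auto intro!: lact_eq_0 simp: pend_pcat)
      qed simp
      then show ?thesis using Cons * by (cases x) (auto simp: h)
    next
      case Nil
      have "peel c as v [] r = 0" if "(v, as) \<in> B" "pnd r \<noteq> pnd (v, as)" for v as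
        using that
      proof (induction as arbitrary: v r)
        case (Cons \<alpha> as)
        have e: "pnd (tgt Q \<alpha>, as) = pnd (v, \<alpha> # as)" by (simp add: pend_def)
        have "c [(v, [\<alpha>]), (tgt Q \<alpha>, as)] r = 0"
          using balancedD(4)[OF bal, of "[(v, [\<alpha>])]" "(tgt Q \<alpha>, as)" r] * Cons.prems
            Cons_in_B[OF Cons.prems(1)] Nil e by simp
        then show ?case using Cons.IH[of "tgt Q \<alpha>"] Cons.prems Cons_in_B[OF Cons.prems(1)] e
          by (auto intro!: lact_eq_0 simp: pend_pcat)
      qed simp
      then show ?thesis using Nil * by (cases b) (auto simp: h)
    qed
  qed
  then have uh: "unital (Suc n) (Suc n) (hdif n h)"
    using unital_hdif[of "Suc n" n h] ch n by simp
  define d where "d = (\<lambda>z r. c z r - hdif n h z r)"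
  have d: "cocycle Q R (Suc n) d" unfolding d_def by (rule cocycle_diff_hdif[OF c ch])
  have ud: "unital (Suc n) (Suc n) d" using u uh by (simp add: unital_def d_def)
  \<comment> \<open>Peeling the only arrow leaves a trivial path, where \<open>c\<close> vanishes.
    The two bounds on \<open>length ys\<close> together say
    \<open>n = Suc (length ys)\<close>.\<close>
  have h1: "h ((v, [\<alpha>]) # ys) r = 0" if "length ys < n" "n \<le> Suc (length ys)" "set ys \<subseteq> B" "(v, [\<alpha>]) \<in> B" for v \<alpha> ys r
  proof -
    have "c ((v, [\<alpha>]) # triv (tgt Q \<alpha>) # ys) r = 0"
      using unital_full[OF u, of "triv (tgt Q \<alpha>)" "(v, [\<alpha>]) # triv (tgt Q \<alpha>) # ys" r] that Cons_in_B[of v \<alpha> "[]"] by auto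
    then show ?thesis by (simp add: h)
  qed
  \<comment> \<open>By the recursion of \<open>peel\<close>, the value of \<open>h\<close> at
    \<alpha>b is \<alpha> acting on its value at b, minus \<open>c\<close> at (\<alpha>, b). Left
    action and first merge in \<open>hdif n h\<close> therefore leave exactly
    \<open>c\<close>.\<close>
  have arrow: "d ((v, [\<alpha>]) # b # ys) r = 0"
    if *: "length ((v, [\<alpha>]) # b # ys) = Suc n" "set ((v, [\<alpha>]) # b # ys) \<subseteq> B" "nzprod (v, [\<alpha>]) b" for v \<alpha> b ys r
  proof -
    have "merges (\<lambda>z. h ((v, [\<alpha>]) # z) r) (b # ys) = 0"
    proof (rule merges_eq_0, goal_cases)
      case (1 p u w q)
      have "length (b # ys) = Suc (Suc (length p + length q))" "set (b # ys) = set p \<union> {u, w} \<union> set q"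
        unfolding 1(1) by auto
      then show ?case using * 1(2) by (intro h1) auto
    qed
    moreover have "h ((v, [\<alpha>]) # butlast (b # ys)) q = 0" for q
    proof (rule h1)
      show "set (butlast (b # ys)) \<subseteq> B" using * by (meson in_set_butlastD list.set_intros(2) subset_iff)
    qed (use * in auto)
    then have "ract (h (butlast ((v, [\<alpha>]) # b # ys))) p r = 0" for p
      by (intro ract_eq_0) simp
    moreover have "h (pcat (v, [\<alpha>]) b # ys) r = lact (v, [\<alpha>]) (h (b # ys)) r - c ((v, [\<alpha>]) # b # ys) r"
    proof -
      have "b = (tgt Q \<alpha>, snd b)" using *(3) by (cases b) (auto simp: nzprod_def pend_def pstart_def)
      then obtain as where "b = (tgt Q \<alpha>, as)" by blast
      then show ?thesis by (simp add: h pcat_def)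
    qed
    ultimately show ?thesis using * by (simp add: d_def hdif_def)
  qed
  \<comment> \<open>A longer first path is split into its first arrow and the rest; all other terms
    of the cocycle identity for \<open>d\<close> vanish by \<open>arrow\<close> or by
    induction.\<close>
  have "d ((v, as) # b # ys) r = 0"
    if *: "length ((v, as) # b # ys) = Suc n" "set ((v, as) # b # ys) \<subseteq> B" "nzprod (v, as) b" for v as b ys r
    using that
  proof (induction as arbitrary: v b ys r)
    case Nil
    then show ?case using unital_full[OF ud, of "triv v" "triv v # b # ys" r] by simp
  next
    case (Cons \<alpha> as)
    let ?a = "(v, [\<alpha>])" and ?a' = "(tgt Q \<alpha>, as)"
    have aB: "?a \<in> B" "?a' \<in> B" using Cons_in_B[of v \<alpha> as] Cons.prems by auto
    have aa: "nzprod ?a ?a'" "pcat ?a ?a' = (v, \<alpha> # as)"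
      using head_arrow_tail_path[of "(v, \<alpha> # as)"] Cons.prems by (auto simp: head_arrow_def tail_path_def)
    have a'b: "nzprod ?a' b" using nzprod_tail_path[of "(v, \<alpha> # as)" b] Cons.prems by (simp add: tail_path_def)
    have *: "d (?a # ?a' # z) q = 0" if "Suc (length z) = n" "set z \<subseteq> B" for z q
      using that aB aa by (intro arrow) auto
    have "hdif (Suc n) d (?a # ?a' # b # ys) r = 0"
      using Cons.prems aB by (intro cocycle_hdif[OF d]) auto
    moreover have "d (?a' # b # ys) q = 0" for q
      using Cons.prems aB a'b by (intro Cons.IH) auto
    then have "lact ?a (d (?a' # b # ys)) r = 0" by (intro lact_eq_0) auto
    moreover have "d (?a # pcat ?a' b # ys) r = 0"
      using Cons.prems aB a'b aa nzprod_assoc[of ?a ?a' b] by (intro arrow) auto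
    moreover have "merges (\<lambda>z. d (?a # ?a' # z) r) (b # ys) = 0"
    proof (rule merges_eq_0, goal_cases)
      case (1 p u w q)
      have "length (b # ys) = Suc (Suc (length p + length q))" "set (b # ys) = set p \<union> {u, w} \<union> set q"
        unfolding 1(1) by auto
      then show ?case using Cons.prems 1(2) by (intro *) auto
    qed
    moreover have "d (?a # ?a' # butlast (b # ys)) q = 0" for q
    proof (rule *)
      show "set (butlast (b # ys)) \<subseteq> B" using Cons.prems by (meson in_set_butlastD list.set_intros(2) subset_iff)
    qed (use Cons.prems in auto)
    then have "ract (d (butlast (?a # ?a' # b # ys))) p r = 0" for p
      by (intro ract_eq_0) simp
    ultimately show ?case using aa a'b by (simp add: hdif_def)
  qed
  then have "radical 1 (Suc n) d" by (auto simp: radical_def)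
  moreover have "h ds r = 0" if ds: "arrow_list ds" "length ds = n" for ds r
  proof -
    obtain v as ys where z: "ds = (v, as) # ys" using cons ds by blast
    then obtain \<alpha> where "as = [\<alpha>]" using ds by (auto simp: arrow_list_def length_Suc_conv)
    then show ?thesis using ds z h1[of ys v \<alpha> r] by (auto simp: arrow_list_def)
  qed
  ultimately show ?thesis using that[OF ch] ud by (simp add: d_def)
qed

lemma exists_radical:
  assumes c: "cocycle Q R (Suc n) c" and u: "unital (Suc n) (Suc n) c" and n: "0 < n"
  obtains d where "cohom n c d" "cocycle Q R (Suc n) d" "unital (Suc n) (Suc n) d" "radical n (Suc n) d"
    "\<And>ds r. koszul ds \<Longrightarrow> length ds = Suc n \<Longrightarrow> d ds r = c ds r"
proof -
  have "\<exists>d. cohom n c d \<and> unital (Suc n) (Suc n) d \<and> radical j (Suc n) d \<and>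
      (\<forall>ds r. koszul ds \<longrightarrow> length ds = Suc n \<longrightarrow> d ds r = c ds r)" if "j \<le> n" for j
    using that
  proof (induction j)
    case 0
    have "radical 0 (Suc n) c" by (simp add: radical_def)
    then show ?case using cohom_refl u by blast
  next
    case (Suc j)
    then obtain d where d: "cohom n c d" "unital (Suc n) (Suc n) d" "radical j (Suc n) d"
      "\<forall>ds r. koszul ds \<longrightarrow> length ds = Suc n \<longrightarrow> d ds r = c ds r" by auto
    have d': "cocycle Q R (Suc n) d" using cohom_cocycle d assms by blast
    obtain h where h: "is_cochain Q R n h" "unital (Suc n) (Suc n) (\<lambda>z r. d z r - hdif n h z r)"
      "radical (Suc j) (Suc n) (\<lambda>z r. d z r - hdif n h z r)"
      "\<And>ds r. arrow_list ds \<Longrightarrow> length ds = n \<Longrightarrow> h ds r = 0"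
    proof (cases "j = 0")
      case True
      then show ?thesis using radical_step_0[OF d' d(2) n] that by auto
    next
      case False
      then show ?thesis using radical_step_Suc[OF d' d(2,3)] that Suc.prems by auto
    qed
    have "cohom n c (\<lambda>z r. d z r - hdif n h z r)"
      using cohom_trans[OF d(1)] h(1) unfolding cohom_def by blast
    moreover have "d ds r - hdif n h ds r = c ds r" if "koszul ds" "length ds = Suc n" for ds r
      using d(4) hdif_koszul[OF that h(4)] that by simp
    ultimately show ?case using h by blast
  qed
  then show ?thesis using that cohom_cocycle assms by blast
qed

text \<open>Induction on the total number of arrows: a longer path is split, and the three radical
  lemmas reduce to shorter tuples or give zero. In a list of arrows that is not Koszul, some
  neighbours are non-composable or have nonzero product, so \<open>balanced\<close> or
  \<open>radical\<close> applies.\<close>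

lemma zero_of_koszul:
  assumes c: "cocycle Q R (Suc n) c" and u: "unital (Suc n) (Suc n) c" and radical: "radical n (Suc n) c" and n: "0 < n"
    and kos: "\<And>ds r. koszul ds \<Longrightarrow> length ds = Suc n \<Longrightarrow> c ds r = 0"
    and len: "length bs = Suc n" and sub: "set bs \<subseteq> B"
  shows "c bs r = 0"
  using len sub
proof (induction "sum_list (map (\<lambda>p. length (snd p)) bs)" arbitrary: bs r rule: less_induct)
  case less
  note len = less.prems(1) and sub = less.prems(2)
  have bal: "balanced (Suc (Suc n)) (Suc n) c" using balanced_of_unital[OF c u] by simp
  consider p where "p \<in> set bs" "snd p = []" | p where "p \<in> set bs" "length (snd p) > 1" | "arrow_list bs"
    using sub unfolding arrow_list_def
    by (metis length_0_conv less_one linorder_neqE_nat)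
  then show ?case
  proof cases
    case 1
    then show ?thesis using unital_full[OF u _ _ len sub] by blast
  next
    case 2
    then obtain xs ys where bs: "bs = xs @ p # ys" by (metis split_list)
    define a b where "a = head_arrow p" and "b = tail_path p"
    have p: "p \<in> B" "snd p \<noteq> []" using 2 sub by auto
    have ab: "a \<in> B" "b \<in> B" "nzprod a b" "pcat a b = p" "snd a \<noteq> []" "snd b \<noteq> []"
      using head_arrow_tail_path[OF p] 2 by (cases "snd p"; simp add: a_def b_def tail_path_def; fail)+
    have l: "length (snd a) < length (snd p)" "length (snd b) < length (snd p)"
      using arg_cong[OF ab(4), of "\<lambda>p. length (snd p)"] ab(5,6) by (auto simp: neq_Nil_conv)
    have len': "length (xs @ a # b # ys) = Suc (Suc n)" and sub': "set (xs @ a # b # ys) \<subseteq> B"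
      using len sub ab bs by auto
    show ?thesis
    proof (cases "xs = []")
      case True
      have "c (b # ys) q = 0" for q using l len sub bs True ab by (intro less.hyps) auto
      then have "lact a (c (b # ys)) r = 0" by (intro lact_eq_0) auto
      then show ?thesis using radical_first[OF c radical, of a b ys r] len' sub' ab True n bs by auto
    next
      case xs: False
      show ?thesis
      proof (cases "ys = []")
        case True
        have "c (xs @ [a]) q = 0" for q using l len sub bs True ab by (intro less.hyps) auto
        then have "ract (c (xs @ [a])) b r = 0" by (intro ract_eq_0) auto
        then show ?thesis using radical_last[OF c radical, of xs a b r] len' sub' ab True xs bs by auto
      next
        case False
        then have "length xs < n" using len' by (cases ys) auto
        then show ?thesis using radical_interior[OF c radical len' sub' ab(3,5,6) xs _ False] ab bs by auto
      qed
    qed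
  next
    case 3
    show ?thesis
    proof (cases "koszul bs")
      case False
      then obtain i where i: "Suc i < length bs" "\<not> (pnd (bs ! i) = pstart (bs ! Suc i) \<and> \<not> nzprod (bs ! i) (bs ! Suc i))"
        using 3 by (auto simp: koszul_def successively_conv_nth)
      have bs: "bs = take i bs @ bs ! i # bs ! Suc i # drop (Suc (Suc i)) bs"
        using i(1) by (metis Cons_nth_drop_Suc Suc_lessD id_take_nth_drop)
      have li: "length (take i bs) < n" using i len by simp
      show ?thesis
        using i(2) balancedD(2)[OF bal, of "take i bs" "bs ! i" "bs ! Suc i" "drop (Suc (Suc i)) bs" r]
          radD[OF radical, of "take i bs" "bs ! i" "bs ! Suc i" "drop (Suc (Suc i)) bs" r] li len sub
        unfolding bs[symmetric] by auto
    qed (use kos len in blast)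
  qed
qed

subsection \<open>Removing right incidences\<close>

lemma arrow_list_append [simp]: "arrow_list (xs @ ys) \<longleftrightarrow> arrow_list xs \<and> arrow_list ys"
  by (auto simp: arrow_list_def)

lemma koszulD:
  assumes "koszul ds" shows "set ds \<subseteq> B" "p \<in> set ds \<Longrightarrow> snd p \<noteq> []"
  using assms by (auto simp: koszul_def arrow_list_def)

lemma koszul_append: "koszul (xs @ ys) \<Longrightarrow> koszul xs" "koszul (xs @ ys) \<Longrightarrow> koszul ys"
  by (simp_all add: koszul_def successively_append_iff)

lemma koszul_two:
  assumes "koszul (xs @ p # q # ys)"
  shows "pnd p = pstart q" "\<not> nzprod p q" "(last (snd p), hd (snd q)) \<in> R"
proof -
  show *: "pnd p = pstart q" "\<not> nzprod p q" using assms by (auto simp: koszul_def successively_append_iff)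
  show "(last (snd p), hd (snd q)) \<in> R"
    using koszulD(1)[OF assms] koszulD(2)[OF assms] * by (intro not_nzprod_R) auto
qed

lemma koszul_not_closed: "koszul ds \<Longrightarrow> ds \<noteq> [] \<Longrightarrow> pstart (hd ds) \<noteq> pnd (last ds)"
  by (rule chain_not_closed) (auto simp: koszul_def arrow_list_def intro: successively_mono)

lemma arrow_eqI:
  assumes "p \<in> B" "q \<in> B" "length (snd p) = 1" "length (snd q) = 1" "hd (snd p) = hd (snd q)"
  shows "p = q"
  using assms by (cases p; cases q) (auto simp: B_iff length_Suc_conv)

text \<open>The last arrow of \<open>ds\<close> determines its successor by (G1); an empty
  \<open>ds\<close> imposes nothing. This justifies the \<open>THE\<close> in the homotopy of
  \<open>exists_clean\<close>.\<close>

lemma koszul_next_unique: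
  assumes "koszul (ds @ [d])" "koszul (ds @ [d'])" "ds \<noteq> []"
  shows "d = d'"
proof -
  obtain xs e where ds: "ds = xs @ [e]" using assms(3) by (cases ds rule: rev_cases) auto
  have "hd (snd d) = hd (snd d')"
    using koszul_two(3)[of xs e d "[]"] koszul_two(3)[of xs e d' "[]"] assms R_right_unique by (auto simp: ds)
  then show ?thesis
    using assms by (intro arrow_eqI) (auto simp: koszul_def arrow_list_def)
qed

text \<open>Turns an equality of last arrows into the factorisation in which \<open>clean\<close> is
  phrased.\<close>

lemma snoc_split:
  assumes c: "c \<in> B" "snd c \<noteq> []" and d: "d \<in> B" "length (snd d) = 1" "last (snd c) = hd (snd d)"
  obtains w where "w \<in> B" "nzprod w d" "c = pcat w d"
proof -
  obtain v as a where c': "c = (v, as @ [a])" using c(2) by (cases c) (metis append_butlast_last_id snd_conv)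
  have d': "d = (src Q a, [a])" using d by (cases d) (auto simp: length_Suc_conv c' B_iff)
  have "(v, as) \<in> B" using c(1) by (cases as rule: rev_cases) (auto simp: c' B_iff successively_append_iff hd_append)
  moreover have "c = pcat (v, as) d" by (simp add: c' d' pcat_def)
  moreover have "nz_path Q R (pcat (v, as) d)" using c(1) \<open>c = pcat (v, as) d\<close> by (simp add: gbasis_def)
  moreover have "pnd (v, as) = pstart d" using c(1)
    by (cases as rule: rev_cases) (auto simp: c' d' B_iff pend_def pstart_def successively_append_iff)
  ultimately have "(v, as) \<in> B \<and> nzprod (v, as) d \<and> c = pcat (v, as) d" by (simp add: nzprod_def)
  then show ?thesis using that by blast
qed

definition clean :: "nat \<Rightarrow> ('v,'a,'k::field) cochain \<Rightarrow> bool" where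
  "clean n c \<longleftrightarrow> (\<forall>ds d w. koszul (ds @ [d]) \<longrightarrow> length (ds @ [d]) = n \<longrightarrow> w \<in> B \<longrightarrow> nzprod w d \<longrightarrow>
     c (ds @ [d]) (pcat w d) = 0)"

text \<open>The homotopy continues \<open>ds\<close> by its unique next arrow \<open>d\<close> and
  divides the value of \<open>c\<close> by \<open>d\<close> on the right. The right action in the
  differential multiplies back and so produces the components to be removed; the factor
  \<open>(-1) ^ Suc n\<close> compensates the sign of that action.\<close>

lemma exists_clean:
  assumes c: "cocycle Q R (Suc n) c" and u: "unital (Suc n) (Suc n) c" and n: "0 < n"
  obtains d where "cohom n c d" "cocycle Q R (Suc n) d" "unital (Suc n) (Suc n) d" "clean (Suc n) d"
proof -
  define h where "h ds w = (if length ds = n \<and> w \<in> B \<and> (\<exists>d. koszul (ds @ [d]) \<and> nzprod w d)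
    then (-1) ^ Suc n * c (ds @ [THE d. koszul (ds @ [d])]) (pcat w (THE d. koszul (ds @ [d]))) else 0)" for ds w
  have bal: "balanced (Suc (Suc n)) (Suc n) c" using balanced_of_unital[OF c u] by simp
  have the: "(THE d. koszul (ds @ [d])) = d" if "koszul (ds @ [d])" "length ds = n" for ds d
    by (rule the_equality, rule that(1), rule koszul_next_unique[OF _ that(1)]) (use that(2) n in auto)
  have h1: "h ds w = (-1) ^ Suc n * c (ds @ [d]) (pcat w d)"
    if "koszul (ds @ [d])" "length ds = n" "w \<in> B" "nzprod w d" for ds d w
    using that the[OF that(1,2)] by (auto simp: h_def)
  have h2: "\<exists>d. koszul (ds @ [d]) \<and> nzprod w d \<and> length ds = n \<and> w \<in> B \<and> c (ds @ [d]) (pcat w d) \<noteq> 0"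
    if h: "h ds w \<noteq> 0" for ds w
  proof -
    obtain d where d: "koszul (ds @ [d])" "nzprod w d" "length ds = n" "w \<in> B"
      using h by (auto simp: h_def split: if_splits)
    then show ?thesis using h1[of ds d w] h by (intro exI[of _ d]) auto
  qed
  have ch: "is_cochain Q R n h" by (auto simp: is_cochain_def h_def)
  have "balanced (Suc n) n h"
    unfolding balanced_def unital_def
  proof (intro conjI allI impI)
    show "h (xs @ triv v # ys) r = 0" for xs v ys r
    proof (rule ccontr)
      assume "h (xs @ triv v # ys) r \<noteq> 0"
      then obtain d where "koszul ((xs @ triv v # ys) @ [d])" using h2 by blast
      from koszulD(2)[OF this, of "triv v"] show False by simp
    qed
  next
    fix xs and a b :: "('v,'a) path" and ys and r :: "('v,'a) path" assume ab: "pnd a \<noteq> pstart b"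
    show "h (xs @ a # b # ys) r = 0"
    proof (rule ccontr)
      assume "h (xs @ a # b # ys) r \<noteq> 0"
      then obtain d where "koszul ((xs @ a # b # ys) @ [d])" using h2 by blast
      then show False using koszul_two(1)[of xs a b "ys @ [d]"] ab by simp
    qed
  next
    fix b :: "('v,'a) path" and ys and r :: "('v,'a) path"
    assume ab: "pstart r \<noteq> pstart b" and len: "length (b # ys) = n"
    show "h (b # ys) r = 0"
    proof (rule ccontr)
      assume "h (b # ys) r \<noteq> 0"
      then obtain d where d: "koszul ((b # ys) @ [d])" "c ((b # ys) @ [d]) (pcat r d) \<noteq> 0" using h2 by blast
      then show False using balancedD(3)[OF bal, of b "ys @ [d]" "pcat r d"] ab len koszulD(1)[OF d(1)] by simp
    qed
  next
    fix xs and b r :: "('v,'a) path" assume ab: "pnd r \<noteq> pnd b"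
    show "h (xs @ [b]) r = 0"
    proof (rule ccontr)
      assume "h (xs @ [b]) r \<noteq> 0"
      then obtain d where d: "koszul ((xs @ [b]) @ [d])" "nzprod r d" using h2 by blast
      then show False using koszul_two(1)[of xs b d "[]"] ab by (simp add: nzprod_def)
    qed
  qed
  then have uh: "unital (Suc n) (Suc n) (hdif n h)"
    using unital_hdif[of "Suc n" n h] ch n by simp
  have "c (ds @ [d]) (pcat w d) = hdif n h (ds @ [d]) (pcat w d)"
    if k: "koszul (ds @ [d])" and len: "length (ds @ [d]) = Suc n" and w: "w \<in> B" "nzprod w d" for ds d w
  proof -
    obtain e es where ds: "ds = e # es" using len n by (cases ds) auto
    \<comment> \<open>A nonzero value needs an arrow \<open>d'\<close> with \<open>d d'\<close> zero
      but \<open>q d'\<close> nonzero. Since \<open>e q = w d\<close>, the path \<open>q\<close>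
      ends in \<open>d\<close>, a contradiction; \<open>q\<close> is nontrivial because a Koszul
      tuple is not closed.\<close>
    have "lact e (h (es @ [d])) (pcat w d) = 0"
    proof (rule lact_eq_0, rule ccontr)
      fix q assume q: "q \<in> B" "nzprod e q" "pcat w d = pcat e q" and "h (es @ [d]) q \<noteq> 0"
      then obtain d' where d': "koszul (es @ d # d' # [])" "nzprod q d'" using h2[of "es @ [d]" q] by auto
      have "pstart q = pstart (hd (es @ [d]))"
        using q(2) koszul_two(1)[of "[]" e "hd (es @ [d])" "tl (es @ [d])"] k ds by (cases es) (auto simp: nzprod_def)
      moreover have "pnd q = pnd d" using d' koszul_two(1)[OF d'(1)] by (simp add: nzprod_def)
      moreover have "pstart (hd (es @ [d])) \<noteq> pnd (last (es @ [d]))"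
        using koszul_append(1)[of "es @ [d]" "[d']"] d'(1) by (intro koszul_not_closed) auto
      ultimately have nt: "snd q \<noteq> []" by (cases q) auto
      have "snd d \<noteq> []" "snd d' \<noteq> []" "d' \<in> B" using koszulD[OF d'(1)] by auto
      moreover have "last (snd q) = last (snd d)"
        using arg_cong[OF q(3), of "\<lambda>p. last (snd p)"] nt \<open>snd d \<noteq> []\<close> by simp
      ultimately show False
        using koszul_two(3)[OF d'(1)] d'(2) q(1) nt nzprod_nontrivial[of q d'] by simp
    qed
    moreover have "ract (h ds) d (pcat w d) = (-1) ^ Suc n * c (ds @ [d]) (pcat w d)"
      using h1[OF k _ w] w len by simp
    ultimately show ?thesis
      using merges_koszul[OF k] by (simp add: hdif_def ds flip: mult.assoc power_add)
  qed
  then have "clean (Suc n) (\<lambda>z r. c z r - hdif n h z r)" by (simp add: clean_def)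
  moreover have "unital (Suc n) (Suc n) (\<lambda>z r. c z r - hdif n h z r)"
    using u uh by (simp add: unital_def)
  moreover have "cohom n c (\<lambda>z r. c z r - hdif n h z r)" using ch by (auto simp: cohom_def)
  ultimately show ?thesis using that cohom_cocycle[OF _ c] by blast
qed

text \<open>Every summand of a circle product vanishes separately, so no cancellation between
  different insertions is needed.\<close>

lemma insertion_koszul:
  assumes f: "cocycle Q R (Suc p) f" "unital (Suc p) (Suc p) f" "radical p (Suc p) f" "clean (Suc p) f"
    and g: "cocycle Q R (Suc q) g" "unital (Suc q) (Suc q) g" "clean (Suc q) g"
    and pq: "0 < p" "0 < q"
    and k: "koszul (us @ ds @ ws)" and len: "length ds = Suc q" "length us + length ws = p" and c: "c \<in> B"
  shows "g ds c * f (us @ c # ws) r = 0"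
proof (rule ccontr)
  assume nz: "g ds c * f (us @ c # ws) r \<noteq> 0"
  have balf: "balanced (Suc (Suc p)) (Suc p) f" using balanced_of_unital[OF f(1,2)] by simp
  have balg: "balanced (Suc (Suc q)) (Suc q) g" using balanced_of_unital[OF g(1,2)] by simp
  have kd: "koszul ds" using k koszul_append by blast
  obtain d0 ds' where ds: "ds = d0 # ds'" using len by (cases ds) auto
  obtain ds0 d where ds2: "ds = ds0 @ [d]" using len by (cases ds rule: rev_cases) auto
  have sub: "set us \<subseteq> B" "set ds \<subseteq> B" "set ws \<subseteq> B" using koszulD(1)[OF k] by auto
  have d0: "d0 \<in> B" "length (snd d0) = 1"
    using kd unfolding ds by (auto simp: koszul_def arrow_list_def)
  have d: "d \<in> B" "length (snd d) = 1"
    using kd unfolding ds2 by (auto simp: koszul_def arrow_list_def)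
  have cs: "pstart c = pstart d0" using balancedD(3)[OF balg, of d0 ds' c] nz len sub ds by auto
  have ce: "pnd c = pnd d" using balancedD(4)[OF balg, of ds0 d c] nz len sub ds2 by auto
  \<comment> \<open>\<open>c\<close> is parallel to the Koszul tuple \<open>ds\<close>, which is not
    closed, so \<open>c\<close> cannot be trivial.\<close>
  have "pstart d0 \<noteq> pnd d" 
    using koszul_not_closed[OF kd] arg_cong[OF ds, of hd] arg_cong[OF ds2, of last] by (auto simp: ds)
  then have nt: "snd c \<noteq> []" using cs ce by (cases c) auto
  have last_c: "last (snd c) \<noteq> hd (snd d)"
  proof
    assume "last (snd c) = hd (snd d)"
    then obtain w where "w \<in> B" "nzprod w d" "c = pcat w d" using snoc_split[OF c nt d] by blast
    then show False using g(3) kd len nz by (simp add: clean_def ds2)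
  qed
  have hd_last: "hd (snd x) = last (snd x)" if "length (snd x) = 1" for x :: "('v,'a) path"
    using that by (cases x) (auto simp: length_Suc_conv)
  show False
  proof (cases ws)
    case (Cons y ws')
    have y: "y \<in> B" "snd y \<noteq> []" using koszulD[OF k] Cons by auto
    have "\<not> nzprod c y" using radD[OF f(3), of us c y ws' r] nz len sub c Cons by auto
    moreover have dy: "pnd d = pstart y" "(last (snd d), hd (snd y)) \<in> R"
      using koszul_two[of "us @ ds0" d y ws'] k by (auto simp: ds2 Cons)
    ultimately have "(last (snd c), hd (snd y)) \<in> R"
      using c y nt ce by (intro not_nzprod_R) auto
    then show False using R_left_unique[OF _ dy(2)] last_c hd_last[OF d(2)] by auto
  next
    case Nil
    \<comment> \<open>With nothing to the right, \<open>0 < p\<close> guarantees an argument to the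
      left of \<open>c\<close>.\<close>
    obtain us0 e where us: "us = us0 @ [e]" using len pq Nil by (cases us rule: rev_cases) auto
    have e: "e \<in> B" "snd e \<noteq> []" using koszulD[OF k] us by auto
    have "\<not> nzprod e c" using radD[OF f(3), of us0 e c "[]" r] nz len sub c Nil us by auto
    moreover have ed: "pnd e = pstart d0" "(last (snd e), hd (snd d0)) \<in> R"
      using koszul_two[of us0 e d0 ds'] k by (auto simp: ds us Nil)
    ultimately have "(last (snd e), hd (snd c)) \<in> R"
      using c e nt cs by (intro not_nzprod_R) auto
    then have hd_c: "hd (snd c) = hd (snd d0)" using ed(2) R_right_unique by blast
    have head_arrow: "head_arrow c = d0"
      using head_arrow_tail_path[OF c nt] d0 hd_c by (intro arrow_eqI) (auto simp: head_arrow_def)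
    note t = head_arrow_tail_path[OF c nt, unfolded head_arrow]
    show False
    proof (cases "snd (tail_path c) = []")
      \<comment> \<open>Now \<open>c\<close> equals \<open>d0\<close>, so the remaining part
        \<open>ds'\<close> of the tuple would be closed; it is nonempty because
        \<open>0 < q\<close>.\<close>
      case True
      have "pnd (tail_path c) = pnd d" using pend_pcat[OF t(3)] t(4) ce by simp
      moreover have "pnd d0 = pstart (tail_path c)" using t(3) by (simp add: nzprod_def)
      ultimately have "pnd d0 = pnd d" using True by (cases "tail_path c") auto
      obtain d1 ds'' where ds': "ds' = d1 # ds''" using len pq ds by (cases ds') auto
      have "pnd d0 = pstart d1" using koszul_two(1)[of "[]" d0 d1 ds''] kd ds ds' by simp
      moreover have "last ds' = d" using ds ds2 ds' by (metis last.simps last_snoc list.distinct(1))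
      moreover have "koszul ds'" using koszul_append(2)[of "[d0]" ds'] kd ds by simp
      ultimately show False using koszul_not_closed[of ds'] ds' \<open>pnd d0 = pnd d\<close> by simp
    next
      case False
      \<comment> \<open>Pulling the tail of \<open>c\<close> out of the last argument leaves a value
        of \<open>f\<close> on the Koszul tuple \<open>us @ [d0]\<close>, where \<open>clean\<close>
        can be used.\<close>
      have "f (us @ [c]) r = ract (f (us @ [d0])) (tail_path c) r"
        using radical_last[OF f(1,3), of us d0 "tail_path c" r] t sub len us Nil d0 by auto
      moreover have "ract (f (us @ [d0])) (tail_path c) r = 0"
      proof (rule ract_eq_0, rule ccontr)
        fix x assume x: "x \<in> B" "nzprod x (tail_path c)" and nzx: "f (us @ [d0]) x \<noteq> 0"
        have kd0: "koszul (us @ [d0])" using koszul_append(1)[of "us @ [d0]" "ds' @ ws"] k by (simp add: ds)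
        have subu: "set (us @ [d0]) \<subseteq> B" "length (us @ [d0]) = Suc p" using sub d0 len Nil by auto
        obtain u us' where u: "us @ [d0] = u # us'" by (cases us) auto
        have "pstart x = pstart u" using balancedD(3)[OF balf, of u us' x] nzx subu unfolding u by auto
        moreover have "pnd x = pnd d0" using balancedD(4)[OF balf, of us d0 x] nzx subu by auto
        moreover have "pstart u \<noteq> pnd d0" using koszul_not_closed[OF kd0] u by (metis last_snoc list.sel(1) snoc_eq_iff_butlast)
        ultimately have ntx: "snd x \<noteq> []" by (cases x) auto
        have "(last (snd x), hd (snd (tail_path c))) \<notin> R" "pnd x = pstart (tail_path c)"
          using x nzprod_nontrivial[OF x(1) t(2) ntx False] by auto
        moreover have "(last (snd d0), hd (snd (tail_path c))) \<notin> R" "pnd d0 = pstart (tail_path c)"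
          using t nzprod_nontrivial[OF t(1,2,5) False] by auto
        moreover have "last (snd y) \<in> arrs Q" "hd (snd y) \<in> arrs Q" if "y \<in> B" "snd y \<noteq> []" for y
          using that by (cases y; auto simp: B_iff dest: last_in_set hd_in_set)+
        \<comment> \<open>Both arrows have nonzero product with the first arrow of the tail, so (S3)
          identifies them.\<close>
        ultimately have "last (snd x) = last (snd d0)"
          using x(1) ntx t False notR_left_unique[of "last (snd x)" "last (snd d0)" "hd (snd (tail_path c))"]
          by (simp add: nontrivial_pend nontrivial_pstart)
        then have "last (snd x) = hd (snd d0)" using hd_last[OF d0(2)] by simp
        then obtain w where "w \<in> B" "nzprod w d0" "x = pcat w d0" using snoc_split[OF x(1) ntx d0] by blast
        then show False using f(4) kd0 nzx subu by (simp add: clean_def)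
      qed
      ultimately show False using nz Nil by simp
    qed
  qed
qed

subsection \<open>The bracket\<close>

lemma coder_cong:
  assumes "set bs \<subseteq> B"
    and "\<And>z r. length z = Suc p \<Longrightarrow> set z \<subseteq> B \<Longrightarrow> r \<in> B \<Longrightarrow> g z r = g' z r"
    and "\<And>z. length z + p = length bs \<Longrightarrow> set z \<subseteq> B \<Longrightarrow> F z = F' z"
  shows "coder B p g F bs = coder B p g' F' bs"
  unfolding coder_def
proof (intro sum.cong refl arg_cong2[of _ _ _ _ "(*)"], goal_cases)
  case (1 i c)
  then show ?case using assms(1) by (intro assms(2)) (auto dest: in_set_takeD in_set_dropD)
next
  case (2 i c)
  have "set (take i bs) \<subseteq> B" "set (drop (i + Suc p) bs) \<subseteq> B"
    using assms(1) set_take_subset set_drop_subset by fastforce+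
  then show ?case using 2 by (intro assms(3)) auto
qed

lemma brkt_cong:
  assumes "set bs \<subseteq> B" "length bs = Suc (p + q)"
    and "\<And>z r. length z = Suc p \<Longrightarrow> set z \<subseteq> B \<Longrightarrow> f z r = f' z r"
    and "\<And>z r. length z = Suc q \<Longrightarrow> set z \<subseteq> B \<Longrightarrow> g z r = g' z r"
  shows "brkt B p q f g bs r = brkt B p q f' g' bs r"
proof -
  have "coder B q g (\<lambda>z. f z r) bs = coder B q g' (\<lambda>z. f' z r) bs"
    using assms by (intro coder_cong) auto
  moreover have "coder B p f (\<lambda>z. g z r) bs = coder B p f' (\<lambda>z. g' z r) bs"
    using assms by (intro coder_cong) auto
  ultimately show ?thesis by (simp add: brkt_def)
qed

lemma coder_eq_0:
  assumes "\<And>us ds ws c. bs = us @ ds @ ws \<Longrightarrow> length ds = Suc p \<Longrightarrow> c \<in> B \<Longrightarrow> g ds c * F (us @ c # ws) = (0::'k::field)"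
  shows "coder B p g F bs = 0"
  unfolding coder_def
proof (intro sum.neutral ballI, goal_cases)
  case (1 i)
  have "bs = take i bs @ take (Suc p) (drop i bs) @ drop (i + Suc p) bs"
    by (metis append_take_drop_id drop_drop add.commute)
  then have "g (take (Suc p) (drop i bs)) c * F (take i bs @ c # drop (i + Suc p) bs) = 0" if "c \<in> B" for c
    using that 1 by (intro assms) auto
  then show ?case by (simp add: sum.neutral)
qed

lemma brkt_add_left: "brkt B p q (\<lambda>z r. f z r + f' z r) g bs r = brkt B p q f g bs r + brkt B p q f' g bs r"
  by (simp add: brkt_def coder_def algebra_simps sum.distrib sum_distrib_left)

lemma brkt_add_right: "brkt B p q f (\<lambda>z r. g z r + g' z r) bs r = brkt B p q f g bs r + brkt B p q f g' bs r"
  by (simp add: brkt_def coder_def algebra_simps sum.distrib sum_distrib_left)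

lemma brkt_swap: "brkt B q p g f bs r = - ((-1) ^ (p * q) * brkt B p q f g bs r)"
proof -
  have "(-1) ^ (p * q) * ((-1) ^ (p * q) * x) = x" for x :: 'b
    by (metis left_minus_one_mult_self)
  then show ?thesis by (simp add: brkt_def algebra_simps mult.commute[of q p])
qed

lemma gcirc_eq_coder:
  "length bs = Suc (p + q) \<Longrightarrow> gcirc Q R (Suc p) (Suc q) f g bs r = coder B q g (\<lambda>z. f z r) bs"
  by (simp add: gcirc_def circ_i_def coder_def sum.atLeast1_atMost_eq[unfolded One_nat_def] Suc_diff_le)

lemma gbracket_eq_brkt:
  "length bs = Suc (p + q) \<Longrightarrow> gbracket Q R (Suc p) (Suc q) f g bs r = brkt B p q f g bs r"
  by (simp add: gbracket_def brkt_def gcirc_eq_coder add.commute)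

text \<open>The differential is the bracket with the multiplication cochain, up to sign.\<close>

definition mult :: "('v,'a,'k::field) cochain" where
  "mult bs r = bprod Q R (bs ! 0) (bs ! 1) r"

lemma hdif_eq_brkt:
  assumes "length bs = Suc (Suc p)" "set bs \<subseteq> B"
  shows "hdif (Suc p) f bs r = - brkt B p 1 f mult bs r"
proof -
  have "coder B 1 mult (\<lambda>z. f z r) bs = - merges (\<lambda>z. f z r) bs"
  proof -
    have "coder B 1 mult (\<lambda>z. f z r) bs = (\<Sum>i<Suc p. - ((-1) ^ Suc i *
        (if nzprod (bs ! i) (bs ! Suc i) then f (take i bs @ pcat (bs ! i) (bs ! Suc i) # drop (Suc (Suc i)) bs) r else 0)))"
      unfolding coder_def
    proof (rule sum.cong, goal_cases)
      case (2 i)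
      then have i: "Suc i < length bs" using assms by auto
      have tk: "take (Suc 1) (drop i bs) = [bs ! i, bs ! Suc i]"
        using i by (simp add: Cons_nth_drop_Suc[symmetric] Suc_lessD)
      have "(\<Sum>c\<in>B. mult (take (Suc 1) (drop i bs)) c * f (take i bs @ c # drop (i + Suc 1) bs) r) =
        (\<Sum>c\<in>B. if c = pcat (bs ! i) (bs ! Suc i) then (if nzprod (bs ! i) (bs ! Suc i) then
          f (take i bs @ pcat (bs ! i) (bs ! Suc i) # drop (Suc (Suc i)) bs) r else 0) else 0)"
        unfolding tk by (rule sum.cong) (auto simp: mult_def bprod_eq)
      then show ?case by auto
    qed (use assms in simp)
    then show ?thesis by (simp only: merges_sum[OF assms(1)] sum_negf)
  qed
  moreover have "coder B p f (\<lambda>z. mult z r) bs = ract (f (butlast bs)) (last bs) r + (-1) ^ p * lact (hd bs) (f (tl bs)) r"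
  proof -
    obtain a zs where a: "bs = a # zs" "length zs = Suc p" using assms(1) by (cases bs) auto
    obtain ys b where b: "bs = ys @ [b]" "length ys = Suc p" using assms(1) by (cases bs rule: rev_cases) auto
    have "length bs - p = 2" using assms(1) by simp
    then have "coder B p f (\<lambda>z. mult z r) bs = (\<Sum>c\<in>B. f (take (Suc p) bs) c * mult (c # drop (Suc p) bs) r) +
        (-1) ^ p * (\<Sum>c\<in>B. f (take (Suc p) (drop 1 bs)) c * mult (take 1 bs @ c # drop (1 + Suc p) bs) r)"
      by (simp add: coder_def numeral_2_eq_2)
    also have "(\<Sum>c\<in>B. f (take (Suc p) bs) c * mult (c # drop (Suc p) bs) r) = ract (f (butlast bs)) (last bs) r"
      unfolding ract_def by (rule sum.cong) (auto simp: b mult_def bprod_eq)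
    also have "(\<Sum>c\<in>B. f (take (Suc p) (drop 1 bs)) c * mult (take 1 bs @ c # drop (1 + Suc p) bs) r) =
        lact (hd bs) (f (tl bs)) r"
      unfolding lact_def by (rule sum.cong) (auto simp: a mult_def bprod_eq)
    finally show ?thesis .
  qed
  moreover have "(-1) ^ p * ((-1) ^ p * x) = x" for x :: 'b
    by (metis left_minus_one_mult_self)
  ultimately show ?thesis by (simp add: brkt_def hdif_def algebra_simps)
qed

lemma is_cochain_brkt:
  assumes "is_cochain Q R (Suc p) f" "is_cochain Q R (Suc q) g"
  shows "is_cochain Q R (Suc (p + q)) (brkt B p q f g)"
  unfolding is_cochain_def
proof (intro allI impI, elim conjE)
  fix bs :: "('v,'a) path list" and r assume *: "length bs = Suc (p + q)" "set bs \<subseteq> B" "r \<notin> B"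
  have "coder B q g (\<lambda>z. f z r) bs = 0" "coder B p f (\<lambda>z. g z r) bs = 0"
    using * cochain_outside[OF assms(1), of "_ @ _ # _" r] cochain_outside[OF assms(2), of "_ @ _ # _" r]
    by (auto intro!: coder_eq_0)
  then show "brkt B p q f g bs r = 0" by (simp add: brkt_def)
qed

lemma brkt_zero_left:
  assumes "length bs = Suc (p + q)" "set bs \<subseteq> B" "\<And>z r. length z = Suc p \<Longrightarrow> set z \<subseteq> B \<Longrightarrow> f z r = 0"
  shows "brkt B p q f g bs r = 0"
  using brkt_cong[OF assms(2,1), of f "\<lambda>_ _. 0" g g r] assms(3) by (simp add: brkt_def coder_def)

lemma brkt_zero_right:
  assumes "length bs = Suc (p + q)" "set bs \<subseteq> B" "\<And>z r. length z = Suc q \<Longrightarrow> set z \<subseteq> B \<Longrightarrow> g z r = 0"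
  shows "brkt B p q f g bs r = 0"
  using brkt_cong[OF assms(2,1), of f f g "\<lambda>_ _. 0" r] assms(3) by (simp add: brkt_def coder_def)

text \<open>The Jacobi identity with \<open>mult\<close> as third entry; the term with the bracket
  of \<open>f\<close> and \<open>mult\<close> drops out since \<open>f\<close> is a cocycle. Nothing
  is assumed about \<open>g\<close>, so \<open>g\<close> may be the homotopy of a
  coboundary.\<close>

lemma hdif_brkt:
  assumes f: "cocycle Q R (Suc p) f" and len: "length bs = Suc (Suc (p + q))" and sub: "set bs \<subseteq> B"
  shows "hdif (Suc (p + q)) (brkt B p q f g) bs r = brkt B p (Suc q) f (hdif (Suc q) g) bs r"
proof -
  have "hdif (Suc (p + q)) (brkt B p q f g) bs r = - brkt B (p + q) 1 (brkt B p q f g) mult bs r"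
    using len sub by (rule hdif_eq_brkt)
  also have "\<dots> = - ((-1) ^ (q * 1) * brkt B (p + 1) q (brkt B p 1 f mult) g bs r) - brkt B p (q + 1) f (brkt B q 1 g mult) bs r"
    by (subst brkt_Jacobi) (simp only: minus_add_distrib diff_conv_add_uminus)
  also have "brkt B (p + 1) q (brkt B p 1 f mult) g bs r = 0"
    using len sub cocycle_hdif[OF f] hdif_eq_brkt[of _ p f] by (rule_tac brkt_zero_left) auto
  also have "brkt B p (q + 1) f (brkt B q 1 g mult) bs r = brkt B p (Suc q) f (\<lambda>z r. (-1) * hdif (Suc q) g z r) bs r"
    unfolding Suc_eq_plus1[symmetric] using len sub hdif_eq_brkt[of _ q g] by (intro brkt_cong) auto
  also have "\<dots> = - brkt B p (Suc q) f (hdif (Suc q) g) bs r"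
    by (simp add: brkt_def coder_def sum_negf algebra_simps)
  finally show ?thesis by simp
qed

lemma cocycle_brkt:
  assumes f: "cocycle Q R (Suc p) f" and g: "cocycle Q R (Suc q) g"
  shows "cocycle Q R (Suc (p + q)) (brkt B p q f g)"
proof -
  have "brkt B p (Suc q) f (hdif (Suc q) g) bs r = 0" if "length bs = Suc (Suc (p + q))" "set bs \<subseteq> B" for bs r
    using that cocycle_hdif[OF g] by (rule_tac brkt_zero_right) auto
  then show ?thesis
    using is_cochain_brkt[OF cocycle_cochain[OF f] cocycle_cochain[OF g]]
    by (auto simp: cocycle_def hdiff_eq_hdif hdif_brkt[OF f])
qed

section \<open>Coboundaries and reduction to normal cocycles\<close>

definition exact :: "nat \<Rightarrow> ('v,'a,'k::field) cochain \<Rightarrow> bool" where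
  "exact n c \<longleftrightarrow> (\<exists>h. is_cochain Q R n h \<and>
     (\<forall>bs r. length bs = Suc n \<and> set bs \<subseteq> B \<longrightarrow> c bs r = hdif n h bs r))"

lemma exact_add: "exact n c \<Longrightarrow> exact n d \<Longrightarrow> exact n (\<lambda>z r. c z r + d z r)"
proof -
  assume "exact n c" "exact n d"
  then obtain h h' where "is_cochain Q R n h" "is_cochain Q R n h'"
    "\<forall>bs r. length bs = Suc n \<and> set bs \<subseteq> B \<longrightarrow> c bs r = hdif n h bs r"
    "\<forall>bs r. length bs = Suc n \<and> set bs \<subseteq> B \<longrightarrow> d bs r = hdif n h' bs r"
    unfolding exact_def by blast
  then show ?thesis unfolding exact_def
    by (intro exI[of _ "\<lambda>z r. h z r + h' z r"]) (auto simp: hdif_add is_cochain_def)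
qed

lemma exact_scale: "exact n c \<Longrightarrow> exact n (\<lambda>z r. x * c z r)"
proof -
  assume "exact n c"
  then obtain h where "is_cochain Q R n h" "\<forall>bs r. length bs = Suc n \<and> set bs \<subseteq> B \<longrightarrow> c bs r = hdif n h bs r"
    unfolding exact_def by blast
  then show ?thesis unfolding exact_def
    by (intro exI[of _ "\<lambda>z r. x * h z r"]) (auto simp: hdif_scale is_cochain_def)
qed

lemma exact_brkt_right:
  assumes "cocycle Q R (Suc p) f" "is_cochain Q R (Suc q) h"
  shows "exact (Suc (p + q)) (brkt B p (Suc q) f (hdif (Suc q) h))"
  unfolding exact_def using is_cochain_brkt[OF cocycle_cochain[OF assms(1)] assms(2)] hdif_brkt[OF assms(1)]
  by (intro exI[of _ "brkt B p q f h"]) auto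

lemma exact_brkt_left:
  assumes "cocycle Q R (Suc q) g" "is_cochain Q R (Suc p) h"
  shows "exact (Suc (p + q)) (brkt B (Suc p) q (hdif (Suc p) h) g)"
proof -
  have "brkt B (Suc p) q (hdif (Suc p) h) g = (\<lambda>z r. (- ((-1) ^ (q * Suc p))) * brkt B q (Suc p) g (hdif (Suc p) h) z r)"
    by (intro ext) (simp only: brkt_swap[of "Suc p" q] minus_mult_left)
  then show ?thesis
    using exact_scale[OF exact_brkt_right[OF assms], of "- ((-1) ^ (q * Suc p))"]
    by (simp only: add.commute[of q p])
qed

text \<open>Cleaning precedes the normalisation at the arrows: the latter keeps Koszul values and
  therefore \<open>clean\<close>, whereas the cleaning homotopy is only known to preserve
  unitality.\<close>

lemma exists_normal:
  assumes "cocycle Q R (Suc n) c" "0 < n"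
  obtains d where "cohom n c d" "cocycle Q R (Suc n) d" "unital (Suc n) (Suc n) d" "radical n (Suc n) d" "clean (Suc n) d"
proof -
  obtain c1 where c1: "cohom n c c1" "cocycle Q R (Suc n) c1" "unital (Suc n) (Suc n) c1"
    using exists_unital[OF assms(1)] by blast
  obtain c2 where c2: "cohom n c1 c2" "cocycle Q R (Suc n) c2" "unital (Suc n) (Suc n) c2" "clean (Suc n) c2"
    using exists_clean[OF c1(2,3) assms(2)] by blast
  obtain c3 where c3: "cohom n c2 c3" "cocycle Q R (Suc n) c3" "unital (Suc n) (Suc n) c3" "radical n (Suc n) c3"
    "\<And>ds r. koszul ds \<Longrightarrow> length ds = Suc n \<Longrightarrow> c3 ds r = c2 ds r"
    using exists_radical[OF c2(2,3) assms(2)] by blast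
  have "clean (Suc n) c3" using c2(4) c3(5) by (simp add: clean_def)
  then show ?thesis using that c3 cohom_trans c1(1) c2(1) by blast
qed

text \<open>A trivial argument lies either in the inserted block or outside it, so the inserted or
  the outer cochain vanishes.\<close>

lemma unital_brkt:
  assumes "unital (Suc p) (Suc p) f" "unital (Suc q) (Suc q) g"
  shows "unital (Suc (p + q)) (Suc (p + q)) (brkt B p q f g)"
proof -
  have *: "g ds c * f (us @ c # ws) r = 0"
    if f: "unital (Suc p) (Suc p) f" and g: "unital (Suc q) (Suc q) g"
      and "length (us @ ds @ ws) = Suc (p + q)" "set (us @ ds @ ws) \<subseteq> B"
      "t \<in> set (us @ ds @ ws)" "snd t = []" "length ds = Suc q" "c \<in> B"
    for p q f g us ds ws c r and t :: "('v,'a) path"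
  proof (cases "t \<in> set ds")
    case True
    then show ?thesis using that unital_full[OF g True] by auto
  next
    case False
    then show ?thesis using that unital_full[OF f, of t "us @ c # ws" r] by auto
  qed
  show ?thesis unfolding unital_def
  proof (intro allI impI)
    fix xs v and ys :: "('v,'a) path list" and r
    let ?bs = "xs @ triv v # ys"
    assume bs: "length ?bs = Suc (p + q)" "set ?bs \<subseteq> B"
    have "triv v \<in> set ?bs" by simp
    then have "coder B q g (\<lambda>z. f z r) ?bs = 0" "coder B p f (\<lambda>z. g z r) ?bs = 0"
      using bs by (intro coder_eq_0 *[OF assms, of _ _ _ "triv v"] *[OF assms(2,1), of _ _ _ "triv v"];
        simp add: add.commute; fail)+
    then show "brkt B p q f g ?bs r = 0" by (simp add: brkt_def)
  qed
qed

text \<open>The bracket need not be \<open>radical\<close> itself, so it is normalised once more.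
  This keeps its Koszul values at zero, so the resulting cocycle vanishes on all tuples of basis
  paths and the homotopy is a primitive.\<close>

lemma exact_brkt_normal:
  assumes f: "cocycle Q R (Suc p) f" "unital (Suc p) (Suc p) f" "radical p (Suc p) f" "clean (Suc p) f"
    and g: "cocycle Q R (Suc q) g" "unital (Suc q) (Suc q) g" "radical q (Suc q) g" "clean (Suc q) g"
    and pq: "0 < p" "0 < q"
  shows "exact (p + q) (brkt B p q f g)"
proof -
  let ?c = "brkt B p q f g"
  have c: "cocycle Q R (Suc (p + q)) ?c" using f g by (intro cocycle_brkt)
  have u: "unital (Suc (p + q)) (Suc (p + q)) ?c" using f g by (intro unital_brkt)
  have k: "?c ds r = 0" if "koszul ds" "length ds = Suc (p + q)" for ds r
  proof -
    have "coder B q g (\<lambda>z. f z r) ds = 0"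
      using that by (intro coder_eq_0 insertion_koszul[OF f g(1,2,4) pq]) auto
    moreover have "coder B p f (\<lambda>z. g z r) ds = 0"
      using that by (intro coder_eq_0 insertion_koszul[OF g f(1,2,4) pq(2,1)]) auto
    ultimately show ?thesis by (simp add: brkt_def)
  qed
  obtain d where d: "cohom (p + q) ?c d" "cocycle Q R (Suc (p + q)) d" "unital (Suc (p + q)) (Suc (p + q)) d"
    "radical (p + q) (Suc (p + q)) d" "\<And>ds r. koszul ds \<Longrightarrow> length ds = Suc (p + q) \<Longrightarrow> d ds r = ?c ds r"
    using exists_radical[OF c u] pq by auto
  have "d bs r = 0" if "length bs = Suc (p + q)" "set bs \<subseteq> B" for bs r
    using zero_of_koszul[OF d(2-4) _ _ that] d(5) k pq by auto
  moreover obtain h where "is_cochain Q R (p + q) h" "d = (\<lambda>z r. ?c z r - hdif (p + q) h z r)"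
    using d(1) by (auto simp: cohom_def)
  ultimately show ?thesis unfolding exact_def by (intro exI[of _ h]) auto
qed

text \<open>The two entries are exchanged one after the other, so that the bracket with a coboundary
  always has a cocycle as its other entry: \<open>f'\<close> in one case, the original
  \<open>g\<close> in the other.\<close>

theorem exact_brkt:
  assumes f: "cocycle Q R (Suc p) f" and g: "cocycle Q R (Suc q) g" and pq: "0 < p" "0 < q"
  shows "exact (p + q) (brkt B p q f g)"
proof -
  \<comment> \<open>The homotopies have degrees \<open>p\<close> and \<open>q\<close>, and
    \<open>hdif_eq_brkt\<close> treats cochains of positive degree only.\<close>
  obtain p' q' where p': "p = Suc p'" and q': "q = Suc q'" using pq by (cases p; cases q) auto
  obtain f' where f': "cohom p f f'" "cocycle Q R (Suc p) f'" "unital (Suc p) (Suc p) f'" "radical p (Suc p) f'" "clean (Suc p) f'"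
    using exists_normal[OF f pq(1)] by blast
  obtain g' where g': "cohom q g g'" "cocycle Q R (Suc q) g'" "unital (Suc q) (Suc q) g'" "radical q (Suc q) g'" "clean (Suc q) g'"
    using exists_normal[OF g pq(2)] by blast
  obtain h where h: "is_cochain Q R p h" "f' = (\<lambda>z r. f z r - hdif p h z r)" using f'(1) by (auto simp: cohom_def)
  obtain l where l: "is_cochain Q R q l" "g' = (\<lambda>z r. g z r - hdif q l z r)" using g'(1) by (auto simp: cohom_def)
  have "brkt B p q f g = brkt B p q (\<lambda>z r. f' z r + hdif p h z r) g" by (simp add: h(2))
  also have "\<dots> = (\<lambda>z r. brkt B p q f' g z r + brkt B p q (hdif p h) g z r)"
    by (intro ext) (rule brkt_add_left)
  also have "brkt B p q f' g = brkt B p q f' (\<lambda>z r. g' z r + hdif q l z r)" by (simp add: l(2))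
  also have "\<dots> = (\<lambda>z r. brkt B p q f' g' z r + brkt B p q f' (hdif q l) z r)"
    by (intro ext) (rule brkt_add_right)
  finally have "brkt B p q f g = (\<lambda>z r. brkt B p q f' g' z r + brkt B p q f' (hdif q l) z r + brkt B p q (hdif p h) g z r)" .
  moreover have "exact (p + q) (brkt B p q f' (hdif q l))"
    using exact_brkt_right[OF f'(2), of q' l] l(1) by (simp add: q')
  moreover have "exact (p + q) (brkt B p q (hdif p h) g)"
    using exact_brkt_left[OF g, of p' h] h(1) by (simp add: p')
  ultimately show ?thesis
    using exact_brkt_normal[OF f'(2-5) g'(2-5) pq] by (simp add: exact_add)
qed

end

theorem theorem3p2:
  fixes Q :: "('v,'a) quiver" and R :: "('a \<times> 'a) set" and n m :: nat
    and f g :: "('v,'a,'k::field) cochain"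
  assumes "gentle Q R" and "triangular Q"
    and "n > 1" and "m > 1"
    and "cocycle Q R n f" and "cocycle Q R m g"
  shows "coboundary Q R (n + m - 1) (gbracket Q R n m f g)"
proof -
  interpret triangular_gentle Q R using assms by unfold_locales
  obtain p q where n: "n = Suc p" "0 < p" and m: "m = Suc q" "0 < q"
    using assms(3,4) by (cases n; cases m) auto
  have "exact (p + q) (brkt B p q f g)"
    using exact_brkt[of p f q g] assms n m by simp
  then obtain h where h: "is_cochain Q R (p + q) h"
    "\<forall>bs r. length bs = Suc (p + q) \<and> set bs \<subseteq> B \<longrightarrow> brkt B p q f g bs r = hdif (p + q) h bs r"
    unfolding exact_def by blast
  have nm: "n + m - 1 = Suc (p + q)" using n m by simp
  show ?thesis
    unfolding coboundary_def nm
    using h by (auto simp: n(1) m(1) gbracket_eq_brkt hdiff_eq_hdif intro!: exI[of _ h])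
qed

end
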